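(* Let $c_1>c_2>c_3>c_4>0$ and put $$z=\begin{pmatrix}1-\dfrac{c_3^2-c_4^2}{c_1^2-c_2^2}&1-\dfrac{c_1^2(c_3^2-c_4^2)}{c_3^2(c_1^2-c_2^2)}\\[3mm]0&1-\dfrac{c_4^2}{c_3^2}\end{pmatrix},\qquad w=\begin{pmatrix}1-\dfrac{c_4^2}{c_2^2}&0\\[3mm]1-\dfrac{c_1^2(c_2^2-c_4^2)}{c_2^2(c_1^2-c_3^2)}&1-\dfrac{c_2^2-c_4^2}{c_1^2-c_3^2}\end{pmatrix},$$ $$m(z)=\begin{pmatrix}\dfrac{(c_1-c_2-c_3+c_4)^2}{(c_1-c_2+c_3-c_4)^2}&\dfrac{2(c_1c_4-c_2c_3)(c_1^2-c_2^2-c_3^2+c_4^2)}{(c_1+c_2)(c_3+c_4)(c_1-c_2+c_3-c_4)^2}\\[4mm]0&\dfrac{(c_1-c_2)(c_3-c_4)}{(c_1+c_2)(c_3+c_4)}\end{pmatrix},$$ $$m(w)=\begin{pmatrix}\dfrac{(c_1-c_3)(c_2-c_4)}{(c_1+c_3)(c_2+c_4)}&0\\[4mm]\dfrac{2(c_1c_4-c_2c_3)(c_1^2-c_2^2-c_3^2+c_4^2)}{(c_1+c_3)(c_2+c_4)(c_1+c_2-c_3-c_4)^2}&\dfrac{(c_1-c_2-c_3+c_4)^2}{(c_1+c_2-c_3-c_4)^2}\end{pmatrix}.$$ Then $$F_S(m(z))=\frac{(c_1-c_2+c_3-c_4)(c_3+c_4)}{4(c_1-c_2)c_3}\,F_S(z),\qquad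 F_S(m(w))=\frac{(c_1+c_2-c_3-c_4)(c_2+c_4)}{4(c_1-c_3)c_2}\,F_S(w).$$
   Context: The hypergeometric function $F_S$ of a matrix variable $z=\begin{pmatrix}z_1&z_3\\ z_2&z_4\end{pmatrix}$ is $$F_S(z)=\sum_{n\in\mathbb N^4}\frac{(\frac12)_{n_1+n_3}(\frac12)_{n_2+n_4}(\frac12)_{n_1+n_2}(\frac12)_{n_3+n_4}}{(1)_{n_1+n_3}(1)_{n_2+n_4}\,n_1!\,n_2!\,n_3!\,n_4!}\,z_1^{n_1}z_2^{n_2}z_3^{n_3}z_4^{n_4},$$ $\mathbb N=\{0,1,2,\dots\}$, $(a)_k=a(a+1)\cdots(a+k-1)$, convergent for $|z_1|+|z_2|<1$, $|z_3|+|z_4|<1$. Outside this domain $F_S(z)$ is understood through the Euler integral $$F_S(z)=\frac1{\pi^2}\int_0^1\!\!\int_0^1\frac{ds_1\,ds_2}{\sqrt{s_1(1-s_1)s_2(1-s_2)(1-z_1s_1-z_2s_2)(1-z_3s_1-z_4s_2)}}$$ (which equals the series on its domain of convergence), where the two linear factors are nonvanishing on $[0,1]^2$ with arguments continuous and equal to $0$ at $(s_1,s_2)=(0,0)$. Here $m(z)$ and $m(w)$ are just names for the displayed matrices. *)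

theory Defs
  imports "HOL-Analysis.Analysis"
begin

text \<open>
  The hypergeometric function $F_S$ of a matrix variable. The entries of the matrix are numbered
  column by column: $z_1, z_2$ form the first column and $z_3, z_4$ the second one.
\<close>

definition F_S_series :: "complex^2^2 \<Rightarrow> complex" where
  "F_S_series z = (\<Sum>\<^sub>\<infinity>(n1, n2, n3, n4) \<in> (UNIV :: (nat \<times> nat \<times> nat \<times> nat) set).
     (pochhammer (1/2) (n1 + n3) * pochhammer (1/2) (n2 + n4)
        * pochhammer (1/2) (n1 + n2) * pochhammer (1/2) (n3 + n4))
     / (pochhammer 1 (n1 + n3) * pochhammer 1 (n2 + n4)
        * fact n1 * fact n2 * fact n3 * fact n4)
     * (z$1$1) ^ n1 * (z$2$1) ^ n2 * (z$1$2) ^ n3 * (z$2$2) ^ n4)"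

definition F_S_factor :: "complex \<Rightarrow> complex \<Rightarrow> real \<times> real \<Rightarrow> complex" where
  "F_S_factor a b = (\<lambda>(s1, s2). 1 - a * of_real s1 - b * of_real s2)"

text \<open>
  The Euler integral. In each of the two linear factors the square root is taken along the
  argument that is continuous on the unit square and vanishes at the origin. Whenever the factor
  has no zero on the unit square this is the principal argument (see the lemmas
  \<open>continuous_on_Arg_F_S_factor\<close> and \<open>Arg_F_S_factor_0\<close> below), so \<^const>\<open>csqrt\<close> is the right branch.
\<close>

definition F_S_Euler :: "complex^2^2 \<Rightarrow> complex" where
  "F_S_Euler z = 1 / of_real (pi\<^sup>2) *
     (LINT (s1, s2):{0..1} \<times> {0..1}|lborel.
        1 / (of_real (sqrt (s1 * (1 - s1) * s2 * (1 - s2)))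
             * csqrt (F_S_factor (z$1$1) (z$2$1) (s1, s2))
             * csqrt (F_S_factor (z$1$2) (z$2$2) (s1, s2))))"

definition F_S :: "complex^2^2 \<Rightarrow> complex" where
  "F_S z = (if norm (z$1$1) + norm (z$2$1) < 1 \<and> norm (z$1$2) + norm (z$2$2) < 1
            then F_S_series z else F_S_Euler z)"

lemma F_S_factor_not_nonpos_Reals:
  assumes nz: "\<And>s. s \<in> {0..1} \<times> {0..1} \<Longrightarrow> F_S_factor a b s \<noteq> 0"
    and s: "s \<in> {0..1} \<times> {0..1}"
  shows "F_S_factor a b s \<notin> \<real>\<^sub>\<le>\<^sub>0"
proof
  assume "F_S_factor a b s \<in> \<real>\<^sub>\<le>\<^sub>0"
  then obtain r where r: "r \<le> 0" "F_S_factor a b s = of_real r"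
    by (auto elim: nonpos_Reals_cases)
  obtain s1 s2 where s12: "s = (s1, s2)" by (cases s)
  define t where "t = 1 / (1 - r)"
  have t: "0 \<le> t" "t \<le> 1" "t * (1 - r) = 1"
    using r(1) by (auto simp: t_def)
  have "a * of_real s1 + b * of_real s2 = of_real (1 - r)"
    using r(2) by (simp add: F_S_factor_def s12 algebra_simps)
  hence "of_real t * (a * of_real s1 + b * of_real s2) = (of_real (t * (1 - r)) :: complex)"
    by simp
  hence "of_real t * (a * of_real s1 + b * of_real s2) = (1 :: complex)"
    unfolding t(3) by simp
  hence "F_S_factor a b (t * s1, t * s2) = 0"
    by (simp add: F_S_factor_def algebra_simps)
  moreover have "(t * s1, t * s2) \<in> {0..1} \<times> {0..1}"
    using s t(1,2) by (auto simp: s12 intro: mult_le_one)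
  ultimately show False using nz by blast
qed

lemma continuous_on_Arg_F_S_factor:
  assumes "\<And>s. s \<in> {0..1} \<times> {0..1} \<Longrightarrow> F_S_factor a b s \<noteq> 0"
  shows "continuous_on ({0..1} \<times> {0..1}) (\<lambda>s. Arg (F_S_factor a b s))"
proof (rule continuous_on_compose2[of "- \<real>\<^sub>\<le>\<^sub>0" Arg])
  show "continuous_on (- \<real>\<^sub>\<le>\<^sub>0) Arg"
    by (auto intro!: continuous_at_imp_continuous_on continuous_at_Arg)
  show "continuous_on ({0..1} \<times> {0..1}) (F_S_factor a b)"
    unfolding F_S_factor_def case_prod_unfold by (intro continuous_intros)
  show "F_S_factor a b ` ({0..1} \<times> {0..1}) \<subseteq> - \<real>\<^sub>\<le>\<^sub>0"
    using F_S_factor_not_nonpos_Reals[OF assms] by auto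
qed

lemma Arg_F_S_factor_0: "Arg (F_S_factor a b (0, 0)) = 0"
  by (simp add: F_S_factor_def)

end

theory Submission
  imports Defs
begin

text \<open>
  Write \<open>I(d1,d2,d3,d4)\<close> for the integral of \<open>1 / sqrt (u(1+u) r(1+r) (d3 + d1 u + d4 r + d2 u r))\<close>
  over \<open>u, r > 0\<close> (\<open>double_period\<close>). For a triangular matrix, the substitution \<open>s1 = u / (k + u)\<close>,
  \<open>s2 = r / (1 + r)\<close> with \<open>k = 1 - z1\<close> turns the Euler integral, up to the factor \<open>1 / \<pi>^2\<close>, into
  \<open>sqrt (d3 / k) I(d)\<close> (\<open>Euler_period_triangular\<close>). The matrix \<open>z\<close> belongs to \<open>d = (c1^2, c2^2, c3^2, c4^2)\<close> and \<open>m(z)\<close> to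
  \<open>d = ((c1+c2+c3+c4)^2 / 4, (c1+c3)(c2+c4), (c1+c2)(c3+c4), 2(c1 c4 + c2 c3))\<close>. So the first
  identity says that \<open>I\<close> at the former point is twice \<open>I\<close> at the latter
  (\<open>double_period_duplication\<close>, where the symmetry of \<open>I\<close> in \<open>d2\<close> and \<open>d3\<close> has been applied). If \<open>c1 c4 = c2 c3\<close>, then \<open>I\<close> is a product of two complete elliptic
  integrals and this is Gauss's step of the arithmetic-geometric mean in each of them; the general
  statement is the analogue for a two-dimensional period.

  The integral over \<open>r\<close> is a complete elliptic integral \<open>ellK A B\<close> with \<open>A\<close> and \<open>B\<close> linear in \<open>u\<close>.
  Landen's transformation writes it as an integral over a new variable \<open>x\<close> in two ways, \<open>ellK_Heron\<close>
  and \<open>ellK_oval\<close>. The first is used for \<open>I\<close> at the squares \<open>c_i^2\<close>, the second for \<open>I\<close> at the other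
  point. The radicands are quadratic polynomials in \<open>u\<close>, up to the factor \<open>u\<close> or \<open>1 + u\<close>, so after
  interchanging the integrations, the inner integral is again a complete elliptic integral. With
  \<open>y = x^2\<close>, the curves for fixed \<open>x\<close> are
    \<open>Y^2 = u (q0 u^2 + M u + q1)\<close> and \<open>Y^2 = (1+u) (M (1+u) - r0 (1+u)^2 - r1)\<close>,
  where \<open>q0, q1\<close> and \<open>r0, r1\<close> arise from the four factors \<open>y - (c1 + c2)^2\<close>, \<open>y - (c1 - c2)^2\<close>,
  \<open>y - (c3 + c4)^2\<close>, \<open>y - (c3 - c4)^2\<close> by grouping them in pairs in two different ways. Since
  \<open>q0 q1 = r0 r1\<close> and \<open>M\<close> is the same, both curves become \<open>Y^2 = z (z^2 + M z + q0 q1)\<close>, by \<open>z = q0 u\<close>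
  and \<open>z = - r0 (1+u)\<close>: this curve depends on the four factors but not on their grouping. Hence the
  inner integrals agree (\<open>fibre_periods_eq\<close>), and so do the double integrals.

  All these integrals have nonnegative integrands and are taken with values in \<open>[0, \<infinity>]\<close>, so they may
  be interchanged without any discussion of convergence. The second identity follows from the first
  by exchanging \<open>s1\<close> with \<open>s2\<close> and \<open>c2\<close> with \<open>c3\<close>. Since the matrices may lie inside or outside the
  domain of convergence, it is also shown that on this domain the series is the Euler integral
  (\<open>F_S_series_eq_Euler\<close>).
\<close>

section \<open>Integrals of nonnegative functions\<close>

text \<open>
  This form of the substitution rule serves for improper integrals over unbounded intervals, with
  values in \<open>[0, \<infinity>]\<close>. The inverse \<open>h\<close> is a
  parameter because in the applications it is given by a formula.
\<close>

lemma nn_integral_substitution_bij: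
  fixes F :: "real \<Rightarrow> ennreal" and g g' h :: "real \<Rightarrow> real"
  assumes [measurable]: "S \<in> sets borel" "T \<in> sets borel" "F \<in> borel_measurable borel"
      "g \<in> borel_measurable borel" "g' \<in> borel_measurable borel"
    and g: "\<And>x. x \<in> S \<Longrightarrow> g x \<in> T \<and> h (g x) = x"
    and h: "\<And>y. y \<in> T \<Longrightarrow> h y \<in> S \<and> g (h y) = y"
    and der: "\<And>x. x \<in> S \<Longrightarrow> (g has_real_derivative g' x) (at x)"
    and fin: "\<And>y. F y \<noteq> \<infinity>"
  shows "(\<integral>\<^sup>+y\<in>T. F y \<partial>lborel) = (\<integral>\<^sup>+x\<in>S. ennreal \<bar>g' x\<bar> * F (g x) \<partial>lborel)"
proof -
  define f where "f y = enn2real (F y)" for y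
  have [measurable]: "f \<in> borel_measurable borel" unfolding f_def by measurable
  have F: "F y = ennreal (f y)" for y
    using fin[of y] by (simp add: f_def top.not_eq_extremum)
  have f0: "f y \<ge> 0" for y by (simp add: f_def)
  have img: "g ` S = T"
  proof
    show "g ` S \<subseteq> T" using g by auto
    show "T \<subseteq> g ` S" using h by (metis imageI subsetI)
  qed
  have inj: "inj_on g S" using g by (metis inj_onI)
  have SL: "S \<in> sets lebesgue" by simp
  have key: "(\<lambda>x. \<bar>g' x\<bar> * f (g x)) absolutely_integrable_on S \<and>
           integral S (\<lambda>x. \<bar>g' x\<bar> * f (g x)) = b
     \<longleftrightarrow> f absolutely_integrable_on T \<and> integral T f = b" for b
    using has_absolute_integral_change_of_variables_1'[OF SL has_field_derivative_at_within[OF der] inj, of f b]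
    by (simp add: img)
  have char: "(\<integral>\<^sup>+x\<in>A. ennreal (k x) \<partial>lborel) =
      (if k absolutely_integrable_on A then ennreal (integral A k) else \<infinity>)"
    if [measurable]: "A \<in> sets borel" "k \<in> borel_measurable borel" and k0: "\<And>x. k x \<ge> 0"
    for A and k :: "real \<Rightarrow> real"
  proof (cases "k absolutely_integrable_on A")
    case True
    have *: "set_integrable lborel A k"
      using True unfolding set_integrable_def by (subst (asm) integrable_completion) auto
    have "(\<integral>\<^sup>+x\<in>A. ennreal (k x) \<partial>lborel) = (\<integral>\<^sup>+x. ennreal (indicator A x *\<^sub>R k x) \<partial>lborel)"
      by (intro nn_integral_cong) (auto simp: indicator_def)
    also have "\<dots> = ennreal (integral\<^sup>L lborel (\<lambda>x. indicator A x *\<^sub>R k x))"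
      using * k0 unfolding set_integrable_def by (intro nn_integral_eq_integral) auto
    also have "\<dots> = ennreal (integral A k)"
      using set_borel_integral_eq_integral(2)[OF *] by (simp add: set_lebesgue_integral_def)
    finally show ?thesis using True by simp
  next
    case False
    have "\<not> integrable lborel (\<lambda>x. indicator A x *\<^sub>R k x)"
      using False unfolding set_integrable_def by (subst (asm) integrable_completion) auto
    hence "(\<integral>\<^sup>+x. ennreal (indicator A x *\<^sub>R k x) \<partial>lborel) = \<infinity>"
      using k0 integrableI_nonneg[of "\<lambda>x. indicator A x *\<^sub>R k x" lborel]
      by (auto simp: less_top[symmetric])
    moreover have "(\<integral>\<^sup>+x\<in>A. ennreal (k x) \<partial>lborel) = (\<integral>\<^sup>+x. ennreal (indicator A x *\<^sub>R k x) \<partial>lborel)"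
      by (intro nn_integral_cong) (auto simp: indicator_def)
    ultimately show ?thesis using False by simp
  qed
  have "(\<integral>\<^sup>+x\<in>S. ennreal \<bar>g' x\<bar> * F (g x) \<partial>lborel) = (\<integral>\<^sup>+x\<in>S. ennreal (\<bar>g' x\<bar> * f (g x)) \<partial>lborel)"
    by (simp add: F ennreal_mult f0)
  also have "\<dots> = (\<integral>\<^sup>+y\<in>T. ennreal (f y) \<partial>lborel)"
    using key[of "integral T f"] key[of "integral S (\<lambda>x. \<bar>g' x\<bar> * f (g x))"]
    by (subst (1 2) char) (auto simp: f0)
  finally show ?thesis by (simp add: F)
qed

lemma nn_integral_swap_indicator:
  fixes f :: "real \<Rightarrow> real \<Rightarrow> ennreal"
  assumes [measurable]: "(\<lambda>p. f (fst p) (snd p)) \<in> borel_measurable (borel \<Otimes>\<^sub>M borel)" 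
    "S \<in> sets borel" "T \<in> sets borel"
  shows "(\<integral>\<^sup>+x\<in>S. (\<integral>\<^sup>+y\<in>T. f x y \<partial>lborel) \<partial>lborel) = (\<integral>\<^sup>+y\<in>T. (\<integral>\<^sup>+x\<in>S. f x y \<partial>lborel) \<partial>lborel)"
proof -
  have "(\<integral>\<^sup>+x\<in>S. (\<integral>\<^sup>+y\<in>T. f x y \<partial>lborel) \<partial>lborel)
     = (\<integral>\<^sup>+x. (\<integral>\<^sup>+y. f x y * indicator T y * indicator S x \<partial>lborel) \<partial>lborel)"
    by (intro nn_integral_cong) (auto simp: indicator_def)
  also have "\<dots> = (\<integral>\<^sup>+y. (\<integral>\<^sup>+x. f x y * indicator T y * indicator S x \<partial>lborel) \<partial>lborel)"
    by (rule lborel_pair.Fubini'[symmetric]) (simp add: case_prod_unfold)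
  also have "\<dots> = (\<integral>\<^sup>+y\<in>T. (\<integral>\<^sup>+x\<in>S. f x y \<partial>lborel) \<partial>lborel)"
    by (intro nn_integral_cong) (auto simp: indicator_def)
  finally show ?thesis .
qed

text \<open>
  Because \<^term>\<open>sqrt\<close> is odd and \<^term>\<open>ennreal\<close> cuts off negative numbers, this is
  \<open>t powr (-1/2)\<close> for \<open>t > 0\<close> and 0 for \<open>t \<le> 0\<close>. An integral of \<open>inv_sqrt (P x)\<close> is thus automatically
  restricted to the region where the radicand \<open>P\<close> is positive.
\<close>

definition inv_sqrt :: "real \<Rightarrow> ennreal" where
  "inv_sqrt t = ennreal (1 / sqrt t)"

lemma inv_sqrt_measurable [measurable]: "inv_sqrt \<in> borel_measurable borel"
  unfolding inv_sqrt_def by measurable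

lemma inv_sqrt_nonpos: "t \<le> 0 \<Longrightarrow> inv_sqrt t = 0"
  unfolding inv_sqrt_def by (simp add: ennreal_neg divide_nonneg_nonpos)

lemma inv_sqrt_finite: "inv_sqrt t \<noteq> \<infinity>"
  by (simp add: inv_sqrt_def)

lemma inv_sqrt_mult: "0 \<le> a \<Longrightarrow> inv_sqrt (a * b) = inv_sqrt a * inv_sqrt b"
  by (cases "b \<ge> 0")
     (simp_all add: inv_sqrt_def real_sqrt_mult ennreal_mult[symmetric] inv_sqrt_nonpos ennreal_neg mult_nonneg_nonpos divide_nonneg_nonpos)

lemma inv_sqrt_scale:
  assumes "c \<noteq> 0"
  shows "ennreal \<bar>c\<bar> * inv_sqrt (c\<^sup>2 * t) = inv_sqrt t"
proof (cases "t \<ge> 0")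
  case True
  thus ?thesis using assms by (simp add: inv_sqrt_def real_sqrt_mult flip: ennreal_mult)
next
  case False
  thus ?thesis by (simp add: inv_sqrt_nonpos mult_nonneg_nonpos)
qed

lemma inv_sqrt_square: "c > 0 \<Longrightarrow> inv_sqrt (c\<^sup>2) = ennreal (1 / c)"
  by (simp add: inv_sqrt_def)

lemma inv_sqrt_quarter: "inv_sqrt (t / 4) = 2 * inv_sqrt t"
  using inv_sqrt_scale[of 2 "t / 4"] by simp

text \<open>
  The differentials \<open>dx / sqrt (Q x)\<close> and \<open>dy / sqrt (P y)\<close> correspond under \<open>y = g x\<close> if
  \<open>P (g x) = (g' x)^2 Q x\<close>; this identity of radicands is all that remains to be checked in each
  change of variables below.
\<close>

lemma nn_integral_inv_sqrt_substitution:
  fixes P Q :: "real \<Rightarrow> real"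
  assumes "S \<in> sets borel" "T \<in> sets borel" 
      "g \<in> borel_measurable borel" "g' \<in> borel_measurable borel" "P \<in> borel_measurable borel"
    and "\<And>x. x \<in> S \<Longrightarrow> g x \<in> T \<and> h (g x) = x"
    and "\<And>y. y \<in> T \<Longrightarrow> h y \<in> S \<and> g (h y) = y"
    and "\<And>x. x \<in> S \<Longrightarrow> (g has_real_derivative g' x) (at x)"
    and PQ: "\<And>x. x \<in> S \<Longrightarrow> g' x \<noteq> 0 \<and> P (g x) = (g' x)\<^sup>2 * Q x"
  shows "(\<integral>\<^sup>+y\<in>T. inv_sqrt (P y) \<partial>lborel) = (\<integral>\<^sup>+x\<in>S. inv_sqrt (Q x) \<partial>lborel)"
proof -
  have "(\<lambda>y. inv_sqrt (P y)) \<in> borel_measurable borel" using assms(5) by measurable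
  then have "(\<integral>\<^sup>+y\<in>T. inv_sqrt (P y) \<partial>lborel) = (\<integral>\<^sup>+x\<in>S. ennreal \<bar>g' x\<bar> * inv_sqrt (P (g x)) \<partial>lborel)"
    using assms inv_sqrt_finite by (intro nn_integral_substitution_bij[where h = h]) auto
  also have "\<dots> = (\<integral>\<^sup>+x\<in>S. inv_sqrt (Q x) \<partial>lborel)"
    using PQ by (intro nn_integral_cong) (auto simp: indicator_def inv_sqrt_scale)
  finally show ?thesis .
qed

section \<open>Complete elliptic integrals\<close>

text \<open>
  This is \<open>\<pi>\<close> divided by the arithmetic-geometric mean of \<open>sqrt A\<close> and \<open>sqrt B\<close>.
\<close>

definition ellK :: "real \<Rightarrow> real \<Rightarrow> ennreal" where
  "ellK A B = (\<integral>\<^sup>+t\<in>{0<..}. inv_sqrt (t * (t + A) * (t + B)) \<partial>lborel)"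

lemma ellK_Legendre:
  assumes "A > 0" "B > 0"
  shows "(\<integral>\<^sup>+r\<in>{0<..}. inv_sqrt (r * (1 + r) * (A + B * r)) \<partial>lborel) = ellK A B"
  unfolding ellK_def
  by (rule nn_integral_inv_sqrt_substitution[where g = "\<lambda>t. t / B" and g' = "\<lambda>t. 1 / B" and h = "\<lambda>r. B * r"])
     (use assms in \<open>auto intro!: derivative_eq_intros simp: field_simps power2_eq_square\<close>)

lemma ellK_scale:
  assumes "c > 0"
  shows "ellK (c\<^sup>2 * A) (c\<^sup>2 * B) = ennreal (1 / c) * ellK A B"
proof -
  have "ellK (c\<^sup>2 * A) (c\<^sup>2 * B) = (\<integral>\<^sup>+t\<in>{0<..}. inv_sqrt (c\<^sup>2 * (t * (t + A) * (t + B))) \<partial>lborel)"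
    unfolding ellK_def
    by (rule nn_integral_inv_sqrt_substitution[where g = "\<lambda>t. c\<^sup>2 * t" and g' = "\<lambda>t. c\<^sup>2" and h = "\<lambda>r. r / c\<^sup>2"])
       (use assms in \<open>auto intro!: derivative_eq_intros simp: field_simps power2_eq_square\<close>)
  also have "\<dots> = ennreal (1 / c) * ellK A B"
    unfolding ellK_def using assms
    by (subst nn_integral_cmult[symmetric]) (auto simp: inv_sqrt_mult inv_sqrt_square mult.assoc)
  finally show ?thesis .
qed

text \<open>
  Landen's transformation, that is, the invariance of the arithmetic-geometric mean under
  \<open>(P, Q) \<mapsto> ((P + Q) / 2, sqrt (P Q))\<close>. In the Legendre form with \<open>A = ((P + Q) / 2)^2\<close> and \<open>B = P Q\<close>,
  the map \<open>r \<mapsto> (A + B r) / (r (1 + r))\<close> is a decreasing bijection of the positive half-line; it comes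
  from the isogeny of degree 2 between the two elliptic curves.
\<close>

lemma ellK_Landen:
  assumes "P > 0" "Q > 0"
  shows "ellK (P\<^sup>2) (Q\<^sup>2) = ellK (((P + Q) / 2)\<^sup>2) (P * Q)"
proof -
  define A where "A = ((P + Q) / 2)\<^sup>2"
  define B where "B = P * Q"
  have pos: "A > 0" "B > 0" using assms by (auto simp: A_def B_def)
  \<comment> \<open>\<open>h Y\<close> is the positive root \<open>r\<close> of \<open>Y r (1 + r) = A + B r\<close>.\<close>
  define h where "h Y = (B - Y + sqrt ((Y - B)\<^sup>2 + 4 * A * Y)) / (2 * Y)" for Y
  have rad: "(Y - B)\<^sup>2 + 4 * A * Y \<ge> 0" if "Y > 0" for Y using pos that by simp
  have quad: "Y * (h Y)\<^sup>2 + (Y - B) * h Y - A = 0" if "Y > 0" for Y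
  proof -
    define s where "s = sqrt ((Y - B)\<^sup>2 + 4 * A * Y)"
    have s2: "s\<^sup>2 = (Y - B)\<^sup>2 + 4 * A * Y" using rad[OF that] by (simp add: s_def)
    have e: "2 * Y * h Y = B - Y + s" using that by (simp add: h_def s_def)
    have "4 * Y * (Y * (h Y)\<^sup>2 + (Y - B) * h Y - A) = (2 * Y * h Y)\<^sup>2 + 2 * (Y - B) * (2 * Y * h Y) - 4 * A * Y"
      by (simp add: power2_eq_square algebra_simps)
    also have "\<dots> = 0" unfolding e using s2 by (simp add: power2_eq_square algebra_simps)
    finally show ?thesis using that by simp
  qed
  have hpos: "h Y > 0" if "Y > 0" for Y
  proof -
    have "\<bar>Y - B\<bar> < sqrt ((Y - B)\<^sup>2 + 4 * A * Y)"
      using that pos by (intro real_less_rsqrt) simp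
    thus ?thesis using that by (simp add: h_def)
  qed
  have uniq: "r = r'" if "r > 0" "r' > 0" "Y > 0" "Y * r\<^sup>2 + (Y - B) * r - A = 0" "Y * r'\<^sup>2 + (Y - B) * r' - A = 0" for r r' Y
  proof (rule ccontr)
    assume ne: "r \<noteq> r'"
    have "(r - r') * (Y * r * r' + A) = 0"
      using that(4,5) by algebra
    moreover have "Y * r * r' + A > 0" using that pos by (simp add: add_pos_pos)
    ultimately show False using ne by simp
  qed
  have "(\<integral>\<^sup>+Y\<in>{0<..}. inv_sqrt (Y * (Y + P\<^sup>2) * (Y + Q\<^sup>2)) \<partial>lborel) = (\<integral>\<^sup>+r\<in>{0<..}. inv_sqrt (r * (1 + r) * (A + B * r)) \<partial>lborel)"
  proof (rule nn_integral_inv_sqrt_substitution[where g = "\<lambda>r. (A + B * r) / (r * (1 + r))" and h = h and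
        g' = "\<lambda>r. - (B * r\<^sup>2 + 2 * A * r + A) / (r * (1 + r))\<^sup>2"])
    fix r :: real assume "r \<in> {0<..}"
    hence r: "r > 0" by simp
    have gp: "(A + B * r) / (r * (1 + r)) > 0" using r pos by (simp add: add_pos_pos)
    show "(A + B * r) / (r * (1 + r)) \<in> {0<..} \<and> h ((A + B * r) / (r * (1 + r))) = r"
    proof
      show "h ((A + B * r) / (r * (1 + r))) = r"
      proof (rule uniq[OF hpos[OF gp] r gp quad[OF gp]])
        show "(A + B * r) / (r * (1 + r)) * r\<^sup>2 + ((A + B * r) / (r * (1 + r)) - B) * r - A = 0"
          using r by (simp add: divide_simps) (simp add: power2_eq_square algebra_simps)
      qed
    qed (use gp in simp)
    show "((\<lambda>r. (A + B * r) / (r * (1 + r))) has_real_derivative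
         - (B * r\<^sup>2 + 2 * A * r + A) / (r * (1 + r))\<^sup>2) (at r)"
      using r add_pos_pos[OF r mult_pos_pos[OF r r]]
      by (auto intro!: derivative_eq_intros simp: power2_eq_square algebra_simps)
    have num: "B * r\<^sup>2 + 2 * A * r + A > 0" using r pos by (simp add: add_pos_pos)
    define D where "D = r * (1 + r)"
    have D: "D > 0" using r by (simp add: D_def)
    define Y where "Y = (A + B * r) / D"
    have YD: "Y * D = A + B * r" using D by (simp add: Y_def)
    have fac: "(Y + P\<^sup>2) * (Y + Q\<^sup>2) = (Y - B)\<^sup>2 + 4 * A * Y"
      unfolding A_def B_def by (simp add: power2_eq_square field_simps)
    have "D\<^sup>2 * ((Y - B)\<^sup>2 + 4 * A * Y) = (Y * D - B * D)\<^sup>2 + 4 * A * D * (Y * D)"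
      by (simp add: power2_eq_square algebra_simps)
    also have "\<dots> = (B * r\<^sup>2 + 2 * A * r + A)\<^sup>2"
      unfolding YD unfolding D_def by (simp add: power2_eq_square algebra_simps)
    finally have sq: "(Y + P\<^sup>2) * (Y + Q\<^sup>2) = (B * r\<^sup>2 + 2 * A * r + A)\<^sup>2 / D\<^sup>2"
      using D fac by (simp add: field_simps)
    have "Y * (Y + P\<^sup>2) * (Y + Q\<^sup>2) = (- (B * r\<^sup>2 + 2 * A * r + A) / D\<^sup>2)\<^sup>2 * (D * (A + B * r))"
      unfolding mult.assoc sq using D by (simp add: Y_def field_simps power2_eq_square)
    then show "- (B * r\<^sup>2 + 2 * A * r + A) / (r * (1 + r))\<^sup>2 \<noteq> 0 \<and>
         (A + B * r) / (r * (1 + r)) * ((A + B * r) / (r * (1 + r)) + P\<^sup>2) *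
         ((A + B * r) / (r * (1 + r)) + Q\<^sup>2) =
         (- (B * r\<^sup>2 + 2 * A * r + A) / (r * (1 + r))\<^sup>2)\<^sup>2 * (r * (1 + r) * (A + B * r))"
      using num r by (simp add: Y_def D_def)
  next
    fix Y :: real assume "Y \<in> {0<..}"
    hence Y: "Y > 0" by simp
    have hp: "h Y > 0" by (rule hpos[OF Y])
    have "Y * (h Y * (1 + h Y)) = A + B * h Y"
      using quad[OF Y] by (simp add: power2_eq_square algebra_simps)
    hence "(A + B * h Y) / (h Y * (1 + h Y)) = Y"
      using hp by (intro nonzero_divide_eq_eq[THEN iffD2]) auto
    thus "h Y \<in> {0<..} \<and> (A + B * h Y) / (h Y * (1 + h Y)) = Y" using hp by simp
  qed measurable
  also have "\<dots> = ellK A B" by (rule ellK_Legendre[OF pos])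
  finally show ?thesis by (simp add: ellK_def A_def B_def)
qed

text \<open>
  The period over the bounded real oval, between the roots \<open>\<beta>\<close> and \<open>\<alpha>\<close>, equals the one over the
  unbounded oval: \<open>y = \<beta> (t + \<alpha>) / (t + \<beta>)\<close> maps the branch points \<open>0, \<infinity>, -\<alpha>, -\<beta>\<close> to
  \<open>\<alpha>, \<beta>, 0, \<infinity>\<close>.
\<close>

lemma ellK_Moebius:
  assumes "0 < \<beta>" "\<beta> < \<alpha>"
  shows "(\<integral>\<^sup>+y\<in>{0<..}. inv_sqrt (y * (\<alpha> - y) * (y - \<beta>)) \<partial>lborel) = ellK \<alpha> \<beta>"
proof -
  have "(\<integral>\<^sup>+y\<in>{0<..}. inv_sqrt (y * (\<alpha> - y) * (y - \<beta>)) \<partial>lborel) =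
        (\<integral>\<^sup>+y\<in>{\<beta><..<\<alpha>}. inv_sqrt (y * (\<alpha> - y) * (y - \<beta>)) \<partial>lborel)"
  proof (intro nn_integral_cong)
    fix y :: real
    have "inv_sqrt (y * (\<alpha> - y) * (y - \<beta>)) = 0" if "y > 0" "y \<notin> {\<beta><..<\<alpha>}"
    proof (intro inv_sqrt_nonpos)
      have "(\<alpha> - y) * (y - \<beta>) \<le> 0"
        using that assms by (cases "y \<le> \<beta>") (auto intro: mult_nonneg_nonpos mult_nonpos_nonneg)
      thus "y * (\<alpha> - y) * (y - \<beta>) \<le> 0" using that by (simp add: mult.assoc mult_nonneg_nonpos)
    qed
    thus "inv_sqrt (y * (\<alpha> - y) * (y - \<beta>)) * indicator {0<..} y = inv_sqrt (y * (\<alpha> - y) * (y - \<beta>)) * indicator {\<beta><..<\<alpha>} y"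
      using assms by (auto simp: indicator_def)
  qed
  also have "\<dots> = ellK \<alpha> \<beta>" unfolding ellK_def
  proof (rule nn_integral_inv_sqrt_substitution[where g = "\<lambda>t. \<beta> * (t + \<alpha>) / (t + \<beta>)" and
        h = "\<lambda>y. \<beta> * (\<alpha> - y) / (y - \<beta>)" and g' = "\<lambda>t. - \<beta> * (\<alpha> - \<beta>) / (t + \<beta>)\<^sup>2"])
    fix t :: real assume "t \<in> {0<..}"
    hence t: "t > 0" by simp
    have tb: "t + \<beta> > 0" using t assms by simp
    have e1: "\<alpha> - \<beta> * (t + \<alpha>) / (t + \<beta>) = (\<alpha> - \<beta>) * t / (t + \<beta>)"
      using tb by (simp add: field_simps)
    have e2: "\<beta> * (t + \<alpha>) / (t + \<beta>) - \<beta> = \<beta> * (\<alpha> - \<beta>) / (t + \<beta>)"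
      using tb by (simp add: field_simps)
    have "(\<alpha> - \<beta>) * t / (t + \<beta>) > 0" "\<beta> * (\<alpha> - \<beta>) / (t + \<beta>) > 0" using t tb assms by auto
    moreover have "\<beta> * (\<alpha> - \<beta> * (t + \<alpha>) / (t + \<beta>)) / (\<beta> * (t + \<alpha>) / (t + \<beta>) - \<beta>) = t"
      unfolding e1 e2 using tb assms by simp
    ultimately show "\<beta> * (t + \<alpha>) / (t + \<beta>) \<in> {\<beta><..<\<alpha>} \<and>
         \<beta> * (\<alpha> - \<beta> * (t + \<alpha>) / (t + \<beta>)) / (\<beta> * (t + \<alpha>) / (t + \<beta>) - \<beta>) = t"
      using e1 e2 by simp
    show "((\<lambda>t. \<beta> * (t + \<alpha>) / (t + \<beta>)) has_real_derivative - \<beta> * (\<alpha> - \<beta>) / (t + \<beta>)\<^sup>2) (at t)"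
      using tb by (auto intro!: derivative_eq_intros simp: power2_eq_square algebra_simps)
    show "- \<beta> * (\<alpha> - \<beta>) / (t + \<beta>)\<^sup>2 \<noteq> 0 \<and>
         \<beta> * (t + \<alpha>) / (t + \<beta>) * (\<alpha> - \<beta> * (t + \<alpha>) / (t + \<beta>)) * (\<beta> * (t + \<alpha>) / (t + \<beta>) - \<beta>) =
         (- \<beta> * (\<alpha> - \<beta>) / (t + \<beta>)\<^sup>2)\<^sup>2 * (t * (t + \<alpha>) * (t + \<beta>))"
      unfolding e1 e2 using tb assms by (simp add: power2_eq_square mult_ac)
  next
    fix y :: real assume "y \<in> {\<beta><..<\<alpha>}"
    hence y: "\<beta> < y" "y < \<alpha>" by auto
    have e1: "\<beta> * (\<alpha> - y) / (y - \<beta>) + \<alpha> = y * (\<alpha> - \<beta>) / (y - \<beta>)"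
      using y by (simp add: field_simps)
    have e2: "\<beta> * (\<alpha> - y) / (y - \<beta>) + \<beta> = \<beta> * (\<alpha> - \<beta>) / (y - \<beta>)"
      using y by (simp add: field_simps)
    show "\<beta> * (\<alpha> - y) / (y - \<beta>) \<in> {0<..} \<and>
         \<beta> * (\<beta> * (\<alpha> - y) / (y - \<beta>) + \<alpha>) / (\<beta> * (\<alpha> - y) / (y - \<beta>) + \<beta>) = y"
      unfolding e1 e2 using y assms by simp
  qed measurable
  finally show ?thesis .
qed

lemma ellK_measurable [measurable]:
  assumes [measurable]: "f \<in> borel_measurable borel" "g \<in> borel_measurable borel"
  shows "(\<lambda>x. ellK (f x) (g x)) \<in> borel_measurable borel"
  unfolding ellK_def by measurable

text \<open>
  Let \<open>g = sqrt A + sqrt B\<close>. Up to a factor 2, Landen's transformation leads to \<open>ellK (g^2) (4 sqrt (A B))\<close>, and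
  the substitution \<open>t = m x^2 - g^2\<close> makes all square roots of \<open>A\<close> and \<open>B\<close> disappear from the radicand,
  which is Heron's polynomial \<open>(m x^2 - (sqrt A + sqrt B)^2) (m x^2 - (sqrt A - sqrt B)^2)\<close>. The
  condition \<open>A + B < m x^2\<close> selects the values of \<open>x\<close> beyond its largest root. The parameter \<open>m\<close> will be
  the factor \<open>1 + u\<close>, which this substitution absorbs.
\<close>

lemma ellK_Heron:
  assumes "A > 0" "B > 0" "m > 0"
  shows "inv_sqrt m * ellK A B =
    4 * (\<integral>\<^sup>+x\<in>{x. 0 < x \<and> A + B < m * x\<^sup>2}. inv_sqrt ((m * x\<^sup>2 - A - B)\<^sup>2 - 4 * A * B) \<partial>lborel)"
proof -
  define P Q where "P = sqrt A" and "Q = sqrt B"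
  have PQ: "P > 0" "Q > 0" "A = P\<^sup>2" "B = Q\<^sup>2" using assms by (auto simp: P_def Q_def)
  define R where "R x = (m * x\<^sup>2 - A - B)\<^sup>2 - 4 * A * B" for x
  have R: "R x = (m * x\<^sup>2 - (P + Q)\<^sup>2) * (m * x\<^sup>2 - (P - Q)\<^sup>2)" for x
    unfolding R_def PQ(3,4) by (simp add: power2_eq_square algebra_simps)
  have [measurable]: "R \<in> borel_measurable borel" unfolding R_def by measurable
  define x0 where "x0 = (P + Q) / sqrt m"
  have x0: "x0 > 0" "m * x0\<^sup>2 = (P + Q)\<^sup>2" using PQ assms by (auto simp: x0_def power_divide)
  have gt_x0: "x0 < x \<longleftrightarrow> (P + Q)\<^sup>2 < m * x\<^sup>2" if "x > 0" for x
  proof -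
    have "x0 < x \<longleftrightarrow> x0\<^sup>2 < x\<^sup>2" using that x0(1) by (simp add: power_mono_iff flip: not_le)
    also have "\<dots> \<longleftrightarrow> m * x0\<^sup>2 < m * x\<^sup>2" using assms(3) by simp
    finally show ?thesis by (simp only: x0(2))
  qed
  have "ellK A B = ellK ((1/2)\<^sup>2 * (P + Q)\<^sup>2) ((1/2)\<^sup>2 * (4 * P * Q))"
    unfolding PQ(3,4) using ellK_Landen[OF PQ(1,2)] by (simp add: power2_eq_square)
  also have "\<dots> = 2 * ellK ((P + Q)\<^sup>2) (4 * P * Q)"
    by (subst ellK_scale) auto
  also have "ellK ((P + Q)\<^sup>2) (4 * P * Q) = (\<integral>\<^sup>+x\<in>{x0<..}. inv_sqrt (R x / 4 / m) \<partial>lborel)"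
    unfolding ellK_def
  proof (rule nn_integral_inv_sqrt_substitution[where g = "\<lambda>x. m * x\<^sup>2 - (P + Q)\<^sup>2" and
        h = "\<lambda>t. sqrt ((t + (P + Q)\<^sup>2) / m)" and g' = "\<lambda>x. 2 * m * x"])
    fix x assume "x \<in> {x0<..}"
    hence x: "x > x0" "x > 0" using x0 by auto
    thus "m * x\<^sup>2 - (P + Q)\<^sup>2 \<in> {0<..} \<and> sqrt ((m * x\<^sup>2 - (P + Q)\<^sup>2 + (P + Q)\<^sup>2) / m) = x"
      using gt_x0[of x] assms by simp
    show "((\<lambda>x. m * x\<^sup>2 - (P + Q)\<^sup>2) has_real_derivative 2 * m * x) (at x)"
      by (auto intro!: derivative_eq_intros)
    have "m * x\<^sup>2 - (P + Q)\<^sup>2 + 4 * P * Q = m * x\<^sup>2 - (P - Q)\<^sup>2"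
      by (simp add: power2_eq_square algebra_simps)
    thus "2 * m * x \<noteq> 0 \<and> (m * x\<^sup>2 - (P + Q)\<^sup>2) * (m * x\<^sup>2 - (P + Q)\<^sup>2 + (P + Q)\<^sup>2) *
         (m * x\<^sup>2 - (P + Q)\<^sup>2 + 4 * P * Q) = (2 * m * x)\<^sup>2 * (R x / 4 / m)"
      using x assms by (simp add: R power2_eq_square)
  next
    fix t :: real assume "t \<in> {0<..}"
    hence t: "t > 0" by simp
    have e: "m * (sqrt ((t + (P + Q)\<^sup>2) / m))\<^sup>2 = t + (P + Q)\<^sup>2"
      using t assms by simp
    moreover have "sqrt ((t + (P + Q)\<^sup>2) / m) > 0" using t assms by (simp add: add_pos_nonneg)
    ultimately show "sqrt ((t + (P + Q)\<^sup>2) / m) \<in> {x0<..} \<and> m * (sqrt ((t + (P + Q)\<^sup>2) / m))\<^sup>2 - (P + Q)\<^sup>2 = t"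
      using gt_x0[of "sqrt ((t + (P + Q)\<^sup>2) / m)"] t by simp
  qed measurable
  also have "inv_sqrt m * (2 * (\<integral>\<^sup>+x\<in>{x0<..}. inv_sqrt (R x / 4 / m) \<partial>lborel)) =
      4 * (\<integral>\<^sup>+x\<in>{x0<..}. inv_sqrt (R x) \<partial>lborel)"
  proof -
    have "inv_sqrt m * (\<integral>\<^sup>+x\<in>{x0<..}. inv_sqrt (R x / 4 / m) \<partial>lborel) =
        (\<integral>\<^sup>+x. inv_sqrt m * (inv_sqrt (R x / 4 / m) * indicator {x0<..} x) \<partial>lborel)"
      by (subst nn_integral_cmult) auto
    also have "\<dots> = (\<integral>\<^sup>+x. 2 * (inv_sqrt (R x) * indicator {x0<..} x) \<partial>lborel)"
      using inv_sqrt_mult[of m "R x / 4 / m" for x] assms(3)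
      by (intro nn_integral_cong) (simp add: inv_sqrt_quarter flip: mult.assoc)
    also have "\<dots> = 2 * (\<integral>\<^sup>+x\<in>{x0<..}. inv_sqrt (R x) \<partial>lborel)"
      by (subst nn_integral_cmult) auto
    finally have "inv_sqrt m * (\<integral>\<^sup>+x\<in>{x0<..}. inv_sqrt (R x / 4 / m) \<partial>lborel) = 2 * (\<integral>\<^sup>+x\<in>{x0<..}. inv_sqrt (R x) \<partial>lborel)" .
    hence "2 * (inv_sqrt m * (\<integral>\<^sup>+x\<in>{x0<..}. inv_sqrt (R x / 4 / m) \<partial>lborel)) = 2 * (2 * (\<integral>\<^sup>+x\<in>{x0<..}. inv_sqrt (R x) \<partial>lborel))"
      by (rule arg_cong)
    also have "\<dots> = 4 * (\<integral>\<^sup>+x\<in>{x0<..}. inv_sqrt (R x) \<partial>lborel)"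
      by (simp flip: mult.assoc)
    finally show ?thesis by (subst mult.left_commute)
  qed
  also have "(\<integral>\<^sup>+x\<in>{x0<..}. inv_sqrt (R x) \<partial>lborel) =
      (\<integral>\<^sup>+x\<in>{x. 0 < x \<and> A + B < m * x\<^sup>2}. inv_sqrt (R x) \<partial>lborel)"
  proof (intro nn_integral_cong)
    fix x :: real
    have lo: "(P - Q)\<^sup>2 < A + B" "A + B < (P + Q)\<^sup>2"
      using PQ by (auto simp: power2_eq_square algebra_simps)
    have "inv_sqrt (R x) = 0" if "0 < x" "A + B < m * x\<^sup>2" "\<not> x0 < x"
      using that gt_x0[of x] lo by (intro inv_sqrt_nonpos) (auto simp: R intro!: mult_nonpos_nonneg)
    moreover have "0 < x \<and> A + B < m * x\<^sup>2" if "x0 < x"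
      using that x0 gt_x0[of x] lo by auto
    ultimately show "inv_sqrt (R x) * indicator {x0<..} x = inv_sqrt (R x) * indicator {x. 0 < x \<and> A + B < m * x\<^sup>2} x"
      by (auto simp: indicator_def)
  qed
  finally show ?thesis by (simp add: R_def)
qed

text \<open>
  Here Landen's transformation is used in the ascending direction, towards the pair
  \<open>p, q = sqrt A \<plusminus> sqrt (A - B)\<close> whose arithmetic and geometric means are \<open>sqrt A\<close> and \<open>sqrt B\<close>.
  Then \<open>y = m x^2\<close> in the period over the bounded oval gives the radicand
  \<open>(p^2 - m x^2) (m x^2 - q^2)\<close>, which is a polynomial in \<open>A\<close> and \<open>B\<close>.
\<close>

lemma ellK_oval:
  assumes "0 < B" "B < A" "m > 0"
  shows "inv_sqrt m * ellK A B =
    2 * (\<integral>\<^sup>+x\<in>{0<..}. inv_sqrt (4 * A * m * x\<^sup>2 - (m * x\<^sup>2 + B)\<^sup>2) \<partial>lborel)"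
proof -
  define p q where "p = sqrt A + sqrt (A - B)" and "q = sqrt A - sqrt (A - B)"
  have pq: "0 < q" "q < p" "((p + q) / 2)\<^sup>2 = A" "p * q = B"
    using assms by (auto simp: p_def q_def algebra_simps power2_eq_square real_sqrt_less_iff)
  hence pq2: "p\<^sup>2 + q\<^sup>2 = 4 * A - 2 * B" "p\<^sup>2 * q\<^sup>2 = B\<^sup>2" "0 < q\<^sup>2" "q\<^sup>2 < p\<^sup>2"
    by (auto simp: power2_eq_square field_simps intro!: mult_strict_mono)
  define R where "R x = 4 * A * m * x\<^sup>2 - (m * x\<^sup>2 + B)\<^sup>2" for x
  have R: "R x = (p\<^sup>2 - m * x\<^sup>2) * (m * x\<^sup>2 - q\<^sup>2)" for x
  proof -
    have "(p\<^sup>2 - m * x\<^sup>2) * (m * x\<^sup>2 - q\<^sup>2) = (p\<^sup>2 + q\<^sup>2) * (m * x\<^sup>2) - (m * x\<^sup>2)\<^sup>2 - p\<^sup>2 * q\<^sup>2"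
      by (simp add: power2_eq_square algebra_simps)
    thus ?thesis unfolding pq2 R_def by (simp add: power2_eq_square algebra_simps)
  qed
  have [measurable]: "R \<in> borel_measurable borel" unfolding R_def by measurable
  have "ellK A B = ellK (p\<^sup>2) (q\<^sup>2)"
    using ellK_Landen[of p q] pq by simp
  also have "\<dots> = (\<integral>\<^sup>+y\<in>{0<..}. inv_sqrt (y * (p\<^sup>2 - y) * (y - q\<^sup>2)) \<partial>lborel)"
    using ellK_Moebius[OF pq2(3,4)] by simp
  also have "\<dots> = (\<integral>\<^sup>+x\<in>{0<..}. inv_sqrt (R x / 4 / m) \<partial>lborel)"
    by (rule nn_integral_inv_sqrt_substitution[where g = "\<lambda>x. m * x\<^sup>2" and
        h = "\<lambda>y. sqrt (y / m)" and g' = "\<lambda>x. 2 * m * x"])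
       (use assms in \<open>auto intro!: derivative_eq_intros simp: R power2_eq_square\<close>)
  also have "inv_sqrt m * (\<integral>\<^sup>+x\<in>{0<..}. inv_sqrt (R x / 4 / m) \<partial>lborel) =
      (\<integral>\<^sup>+x. inv_sqrt m * (inv_sqrt (R x / 4 / m) * indicator {0<..} x) \<partial>lborel)"
    by (subst nn_integral_cmult) auto
  also have "\<dots> = (\<integral>\<^sup>+x. 2 * (inv_sqrt (R x) * indicator {0<..} x) \<partial>lborel)"
    using inv_sqrt_mult[of m "R x / 4 / m" for x] assms(3)
    by (intro nn_integral_cong) (simp add: inv_sqrt_quarter flip: mult.assoc)
  also have "\<dots> = 2 * (\<integral>\<^sup>+x\<in>{0<..}. inv_sqrt (R x) \<partial>lborel)"
    by (subst nn_integral_cmult) auto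
  finally show ?thesis by (simp add: R_def)
qed

text \<open>
  With \<open>z = q0 u\<close> on the left and \<open>z = r0 (1 + u)\<close> on the right, the radicands are proportional to
  \<open>z (z + z1) (z + z2)\<close> and \<open>z (z2 - z) (z - z1)\<close>, where \<open>z1 < z2\<close> are the roots of
  \<open>z^2 - M z + q0 q1\<close>. So the two sides are the periods over the two ovals of one curve, related by
  \<open>ellK_Moebius\<close>. The last two assumptions ensure \<open>r0 \<le> z1\<close>, so that the bounded oval lies
  within the range \<open>z > r0\<close> of the right-hand side.
\<close>

lemma ellK_two_ovals:
  assumes pos: "q0 > 0" "q1 > 0" "r0 > 0" and prod: "q0 * q1 = r0 * r1"
    and disc: "4 * (q0 * q1) < M\<^sup>2" and M: "2 * r0 < M" and one: "0 \<le> r0 - M + r1"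
  shows "(\<integral>\<^sup>+u\<in>{0<..}. inv_sqrt (u * (q0 * u\<^sup>2 + M * u + q1)) \<partial>lborel) =
         (\<integral>\<^sup>+u\<in>{0<..}. inv_sqrt ((1 + u) * (M * (1 + u) - r0 * (1 + u)\<^sup>2 - r1)) \<partial>lborel)"
proof -
  define s where "s = sqrt (M\<^sup>2 - 4 * (q0 * q1))"
  have s: "s > 0" "s\<^sup>2 = M\<^sup>2 - 4 * (q0 * q1)" using disc by (auto simp: s_def)
  have sM: "s < M" using pos M disc unfolding s_def by (intro real_less_lsqrt) auto
  define z1 z2 where "z1 = (M - s) / 2" and "z2 = (M + s) / 2"
  have z: "0 < z1" "z1 < z2" "z1 + z2 = M" "z1 * z2 = q0 * q1"
    using s sM by (auto simp: z1_def z2_def field_simps power2_eq_square)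
  have split: "(t - z1) * (t - z2) = t\<^sup>2 - M * t + q0 * q1" for t
    using z(3,4) by (simp add: power2_eq_square algebra_simps flip: z(3))
  have "r0 \<le> z1"
  proof (rule ccontr)
    assume "\<not> r0 \<le> z1"
    hence "(r0 - z1) * (r0 - z2) < 0" using M z(1-3) by (intro mult_pos_neg) auto
    moreover have "(r0 - z1) * (r0 - z2) = r0 * (r0 - M + r1)"
      unfolding split prod by (simp add: power2_eq_square algebra_simps)
    ultimately show False using one pos by (simp add: mult_less_0_iff)
  qed
  have "(\<integral>\<^sup>+u\<in>{0<..}. inv_sqrt (u * (q0 * u\<^sup>2 + M * u + q1)) \<partial>lborel) = ellK z2 z1"
    unfolding ellK_def
  proof (rule nn_integral_inv_sqrt_substitution[where g = "\<lambda>t. t / q0" and g' = "\<lambda>t. 1 / q0" and h = "\<lambda>u. q0 * u"])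
    fix t :: real
    have "(t + z2) * (t + z1) = t\<^sup>2 + M * t + q0 * q1"
      using split[of "-t"] by (simp add: algebra_simps)
    thus "1 / q0 \<noteq> 0 \<and> t / q0 * (q0 * (t / q0)\<^sup>2 + M * (t / q0) + q1) = (1 / q0)\<^sup>2 * (t * (t + z2) * (t + z1))"
      using pos by (simp add: mult.assoc) (simp add: field_simps power2_eq_square)
  qed (use pos in \<open>auto intro!: derivative_eq_intros\<close>)
  also have "\<dots> = (\<integral>\<^sup>+z\<in>{0<..}. inv_sqrt (z * (z2 - z) * (z - z1)) \<partial>lborel)"
    using ellK_Moebius[OF z(1,2)] by simp
  also have "\<dots> = (\<integral>\<^sup>+z\<in>{r0<..}. inv_sqrt (z * (z2 - z) * (z - z1)) \<partial>lborel)"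
  proof (intro nn_integral_cong)
    fix t :: real
    have "inv_sqrt (t * (z2 - t) * (t - z1)) = 0" if "0 < t" "t \<le> r0"
      using that z \<open>r0 \<le> z1\<close> by (intro inv_sqrt_nonpos mult_nonneg_nonpos) auto
    thus "inv_sqrt (t * (z2 - t) * (t - z1)) * indicator {0<..} t = inv_sqrt (t * (z2 - t) * (t - z1)) * indicator {r0<..} t"
      using pos by (auto simp: indicator_def)
  qed
  also have "\<dots> = (\<integral>\<^sup>+u\<in>{0<..}. inv_sqrt ((1 + u) * (M * (1 + u) - r0 * (1 + u)\<^sup>2 - r1)) \<partial>lborel)"
  proof (rule nn_integral_inv_sqrt_substitution[where g = "\<lambda>u. r0 * (1 + u)" and g' = "\<lambda>u. r0" and h = "\<lambda>z. z / r0 - 1"])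
    fix u :: real
    have "(z2 - r0 * (1 + u)) * (r0 * (1 + u) - z1) = - ((r0 * (1 + u) - z1) * (r0 * (1 + u) - z2))"
      by (simp add: algebra_simps)
    also have "\<dots> = r0 * (M * (1 + u) - r0 * (1 + u)\<^sup>2 - r1)"
      unfolding split prod by (simp add: power2_eq_square algebra_simps)
    finally show "r0 \<noteq> 0 \<and> r0 * (1 + u) * (z2 - r0 * (1 + u)) * (r0 * (1 + u) - z1) =
         r0\<^sup>2 * ((1 + u) * (M * (1 + u) - r0 * (1 + u)\<^sup>2 - r1))"
      using pos by (simp add: mult.assoc power2_eq_square)
  qed (use pos in \<open>auto intro!: derivative_eq_intros simp: field_simps\<close>)
  finally show ?thesis .
qed

section \<open>The double period and its symmetries\<close>

text \<open>
  A period of the K3 surface \<open>Y^2 = u (1 + u) r (1 + r) (d3 + d1 u + d4 r + d2 u r)\<close>.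
\<close>

definition double_period :: "real \<Rightarrow> real \<Rightarrow> real \<Rightarrow> real \<Rightarrow> ennreal" where
  "double_period d1 d2 d3 d4 = (\<integral>\<^sup>+u\<in>{0<..}. (\<integral>\<^sup>+r\<in>{0<..}.
     inv_sqrt (u * (1 + u) * r * (1 + r) * (d3 + d1 * u + d4 * r + d2 * u * r)) \<partial>lborel) \<partial>lborel)"

lemma double_period_ellK:
  assumes "d1 > 0" "d2 > 0" "d3 > 0" "d4 > 0"
  shows "double_period d1 d2 d3 d4 =
    (\<integral>\<^sup>+u\<in>{0<..}. inv_sqrt (u * (1 + u)) * ellK (d3 + d1 * u) (d4 + d2 * u) \<partial>lborel)"
  unfolding double_period_def
proof (intro nn_integral_cong)
  fix u :: real
  show "(\<integral>\<^sup>+r\<in>{0<..}. inv_sqrt (u * (1 + u) * r * (1 + r) * (d3 + d1 * u + d4 * r + d2 * u * r)) \<partial>lborel) * indicator {0<..} u =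
    inv_sqrt (u * (1 + u)) * ellK (d3 + d1 * u) (d4 + d2 * u) * indicator {0<..} u"
  proof (cases "u > 0")
    case True
    have pos: "d3 + d1 * u > 0" "d4 + d2 * u > 0" using assms True by (auto intro!: add_pos_pos)
    have "inv_sqrt (u * (1 + u)) * ellK (d3 + d1 * u) (d4 + d2 * u) =
        (\<integral>\<^sup>+r. inv_sqrt (u * (1 + u)) * (inv_sqrt (r * (1 + r) * (d3 + d1 * u + (d4 + d2 * u) * r)) * indicator {0<..} r) \<partial>lborel)"
      using ellK_Legendre[OF pos] by (subst nn_integral_cmult) auto
    also have "\<dots> = (\<integral>\<^sup>+r\<in>{0<..}. inv_sqrt (u * (1 + u) * r * (1 + r) * (d3 + d1 * u + d4 * r + d2 * u * r)) \<partial>lborel)"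
    proof (intro nn_integral_cong)
      fix r :: real
      have e: "u * (1 + u) * r * (1 + r) * (d3 + d1 * u + d4 * r + d2 * u * r) =
         (u * (1 + u)) * (r * (1 + r) * (d3 + d1 * u + (d4 + d2 * u) * r))" by algebra
      show "inv_sqrt (u * (1 + u)) * (inv_sqrt (r * (1 + r) * (d3 + d1 * u + (d4 + d2 * u) * r)) * indicator {0<..} r) =
         inv_sqrt (u * (1 + u) * r * (1 + r) * (d3 + d1 * u + d4 * r + d2 * u * r)) * indicator {0<..} r"
        unfolding e using True by (subst inv_sqrt_mult[of "u * (1 + u)"]) (simp_all add: mult.assoc)
    qed
    finally show ?thesis using True by simp
  qed simp
qed

lemma double_period_transpose: "double_period d1 d2 d3 d4 = double_period d4 d2 d3 d1"
  unfolding double_period_def by (subst nn_integral_swap_indicator) (auto simp: algebra_simps)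

lemma double_period_exchange:
  assumes "d1 > 0" "d2 > 0" "d3 > 0" "d4 > 0"
  shows "double_period d1 d2 d3 d4 = double_period d2 d1 d4 d3"
  using assms by (simp add: double_period_ellK ellK_def mult_ac)

text \<open>
  Arrange \<open>d3, d4\<close> and \<open>d1, d2\<close> as the rows of a matrix. Transposing it exchanges the roles of \<open>u\<close> and
  \<open>r\<close>, exchanging its columns is the symmetry of \<open>ellK\<close>. Together they yield the reflection in the
  other diagonal.
\<close>

lemma double_period_antitranspose:
  assumes "d1 > 0" "d2 > 0" "d3 > 0" "d4 > 0"
  shows "double_period d1 d2 d3 d4 = double_period d1 d3 d2 d4"
  using double_period_exchange[of d1 d2 d3 d4] double_period_transpose[of d2 d1 d4 d3] double_period_exchange[of d3 d1 d4 d2] assms by simp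

section \<open>Duplication of the double period\<close>

text \<open>
  The factor \<open>1 + u\<close> of the radicand is the parameter \<open>m\<close> of \<open>ellK_Heron\<close>, so it disappears and the
  remaining radicand is \<open>u\<close> times a quadratic polynomial in \<open>u\<close>.
\<close>

lemma double_period_by_Heron:
  assumes "c1 > 0" "c2 > 0" "c3 > 0" "c4 > 0"
  shows "double_period (c1\<^sup>2) (c2\<^sup>2) (c3\<^sup>2) (c4\<^sup>2) =
    4 * (\<integral>\<^sup>+x\<in>{0<..}. (\<integral>\<^sup>+u\<in>{u. 0 < u \<and> (c3\<^sup>2 + c1\<^sup>2 * u) + (c4\<^sup>2 + c2\<^sup>2 * u) < (1 + u) * x\<^sup>2}.
       inv_sqrt (u * (((1 + u) * x\<^sup>2 - (c3\<^sup>2 + c1\<^sup>2 * u) - (c4\<^sup>2 + c2\<^sup>2 * u))\<^sup>2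
                 - 4 * (c3\<^sup>2 + c1\<^sup>2 * u) * (c4\<^sup>2 + c2\<^sup>2 * u))) \<partial>lborel) \<partial>lborel)"
proof -
  have sq: "c1\<^sup>2 > 0" "c2\<^sup>2 > 0" "c3\<^sup>2 > 0" "c4\<^sup>2 > 0" using assms by auto
  define A B where "A u = c3\<^sup>2 + c1\<^sup>2 * u" and "B u = c4\<^sup>2 + c2\<^sup>2 * u" for u
  define R where "R u x = ((1 + u) * x\<^sup>2 - A u - B u)\<^sup>2 - 4 * A u * B u" for u x
  define I :: "real \<Rightarrow> real \<Rightarrow> ennreal" where
    "I u x = (if 0 < u \<and> 0 < x \<and> A u + B u < (1 + u) * x\<^sup>2 then inv_sqrt (u * R u x) else 0)" for u x
  have [measurable]: "case_prod I \<in> borel_measurable (lborel \<Otimes>\<^sub>M lborel)"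
    unfolding I_def R_def A_def B_def case_prod_unfold by measurable
  have "double_period (c1\<^sup>2) (c2\<^sup>2) (c3\<^sup>2) (c4\<^sup>2) = (\<integral>\<^sup>+u. 4 * (\<integral>\<^sup>+x. I u x \<partial>lborel) \<partial>lborel)"
    unfolding double_period_ellK[OF sq]
  proof (intro nn_integral_cong)
    fix u :: real
    show "inv_sqrt (u * (1 + u)) * ellK (c3\<^sup>2 + c1\<^sup>2 * u) (c4\<^sup>2 + c2\<^sup>2 * u) * indicator {0<..} u
        = 4 * (\<integral>\<^sup>+x. I u x \<partial>lborel)"
    proof (cases "u > 0")
      case True
      have pos: "A u > 0" "B u > 0" using True assms by (auto simp: A_def B_def add_pos_pos)
      have "inv_sqrt (u * (1 + u)) * ellK (A u) (B u) = inv_sqrt u * (inv_sqrt (1 + u) * ellK (A u) (B u))"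
        using True by (simp add: inv_sqrt_mult mult.assoc)
      also have "\<dots> = 4 * (inv_sqrt u * (\<integral>\<^sup>+x\<in>{x. 0 < x \<and> A u + B u < (1 + u) * x\<^sup>2}. inv_sqrt (R u x) \<partial>lborel))"
        using True pos by (subst ellK_Heron) (auto simp: R_def mult.left_commute)
      also have "inv_sqrt u * (\<integral>\<^sup>+x\<in>{x. 0 < x \<and> A u + B u < (1 + u) * x\<^sup>2}. inv_sqrt (R u x) \<partial>lborel)
          = (\<integral>\<^sup>+x. inv_sqrt u * (inv_sqrt (R u x) * indicator {x. 0 < x \<and> A u + B u < (1 + u) * x\<^sup>2} x) \<partial>lborel)"
        unfolding R_def by (subst nn_integral_cmult) auto
      also have "\<dots> = (\<integral>\<^sup>+x. I u x \<partial>lborel)"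
        using True by (intro nn_integral_cong) (auto simp: I_def indicator_def inv_sqrt_mult)
      finally show ?thesis using True by (simp add: A_def B_def)
    qed (simp add: I_def)
  qed
  also have "\<dots> = 4 * (\<integral>\<^sup>+u. (\<integral>\<^sup>+x. I u x \<partial>lborel) \<partial>lborel)"
    by (subst nn_integral_cmult) auto
  also have "(\<integral>\<^sup>+u. (\<integral>\<^sup>+x. I u x \<partial>lborel) \<partial>lborel) = (\<integral>\<^sup>+x. (\<integral>\<^sup>+u. I u x \<partial>lborel) \<partial>lborel)"
    by (rule lborel_pair.Fubini'[symmetric]) simp
  also have "\<dots> = (\<integral>\<^sup>+x\<in>{0<..}. (\<integral>\<^sup>+u\<in>{u. 0 < u \<and> A u + B u < (1 + u) * x\<^sup>2}. inv_sqrt (u * R u x) \<partial>lborel) \<partial>lborel)"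
  proof (intro nn_integral_cong)
    fix x :: real
    show "(\<integral>\<^sup>+u. I u x \<partial>lborel) = (\<integral>\<^sup>+u\<in>{u. 0 < u \<and> A u + B u < (1 + u) * x\<^sup>2}. inv_sqrt (u * R u x) \<partial>lborel) * indicator {0<..} x"
      by (cases "x > 0") (auto simp: I_def indicator_def intro!: nn_integral_cong)
  qed
  finally show ?thesis by (simp add: R_def A_def B_def)
qed

text \<open>
  This time the factor \<open>u\<close> is absorbed into the new variable and \<open>1 + u\<close> remains.
\<close>

lemma double_period_by_oval:
  assumes "d1 > 0" "d2 > 0" "d3 > 0" "d4 > 0" "d4 < d3" "d2 < d1"
  shows "double_period d1 d2 d3 d4 =
    2 * (\<integral>\<^sup>+x\<in>{0<..}. (\<integral>\<^sup>+u\<in>{0<..}.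
       inv_sqrt ((1 + u) * (4 * (d3 + d1 * u) * u * x\<^sup>2 - (u * x\<^sup>2 + (d4 + d2 * u))\<^sup>2)) \<partial>lborel) \<partial>lborel)"
proof -
  define A B where "A u = d3 + d1 * u" and "B u = d4 + d2 * u" for u
  define R where "R u x = 4 * A u * u * x\<^sup>2 - (u * x\<^sup>2 + B u)\<^sup>2" for u x
  define I :: "real \<Rightarrow> real \<Rightarrow> ennreal" where
    "I u x = (if 0 < u \<and> 0 < x then inv_sqrt ((1 + u) * R u x) else 0)" for u x
  have [measurable]: "case_prod I \<in> borel_measurable (lborel \<Otimes>\<^sub>M lborel)"
    unfolding I_def R_def A_def B_def case_prod_unfold by measurable
  have "double_period d1 d2 d3 d4 = (\<integral>\<^sup>+u. 2 * (\<integral>\<^sup>+x. I u x \<partial>lborel) \<partial>lborel)"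
    unfolding double_period_ellK[OF assms(1-4)]
  proof (intro nn_integral_cong)
    fix u :: real
    show "inv_sqrt (u * (1 + u)) * ellK (d3 + d1 * u) (d4 + d2 * u) * indicator {0<..} u
        = 2 * (\<integral>\<^sup>+x. I u x \<partial>lborel)"
    proof (cases "u > 0")
      case True
      have pos: "0 < B u" "B u < A u"
        using True assms by (auto simp: A_def B_def intro!: add_pos_pos add_strict_mono)
      have "inv_sqrt (u * (1 + u)) * ellK (A u) (B u) = inv_sqrt (1 + u) * (inv_sqrt u * ellK (A u) (B u))"
        using True by (simp add: inv_sqrt_mult mult_ac)
      also have "\<dots> = 2 * (inv_sqrt (1 + u) * (\<integral>\<^sup>+x\<in>{0<..}. inv_sqrt (R u x) \<partial>lborel))"
        using True pos by (subst ellK_oval) (auto simp: R_def mult.left_commute)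
      also have "inv_sqrt (1 + u) * (\<integral>\<^sup>+x\<in>{0<..}. inv_sqrt (R u x) \<partial>lborel)
          = (\<integral>\<^sup>+x. inv_sqrt (1 + u) * (inv_sqrt (R u x) * indicator {0<..} x) \<partial>lborel)"
        unfolding R_def by (subst nn_integral_cmult) auto
      also have "\<dots> = (\<integral>\<^sup>+x. I u x \<partial>lborel)"
        using True by (intro nn_integral_cong) (auto simp: I_def indicator_def inv_sqrt_mult)
      finally show ?thesis using True by (simp add: A_def B_def)
    qed (simp add: I_def)
  qed
  also have "\<dots> = 2 * (\<integral>\<^sup>+u. (\<integral>\<^sup>+x. I u x \<partial>lborel) \<partial>lborel)"
    by (subst nn_integral_cmult) auto
  also have "(\<integral>\<^sup>+u. (\<integral>\<^sup>+x. I u x \<partial>lborel) \<partial>lborel) = (\<integral>\<^sup>+x. (\<integral>\<^sup>+u. I u x \<partial>lborel) \<partial>lborel)"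
    by (rule lborel_pair.Fubini'[symmetric]) simp
  also have "\<dots> = (\<integral>\<^sup>+x\<in>{0<..}. (\<integral>\<^sup>+u\<in>{0<..}. inv_sqrt ((1 + u) * R u x) \<partial>lborel) \<partial>lborel)"
  proof (intro nn_integral_cong)
    fix x :: real
    show "(\<integral>\<^sup>+u. I u x \<partial>lborel) = (\<integral>\<^sup>+u\<in>{0<..}. inv_sqrt ((1 + u) * R u x) \<partial>lborel) * indicator {0<..} x"
      by (cases "x > 0") (auto simp: I_def indicator_def intro!: nn_integral_cong)
  qed
  finally show ?thesis by (simp add: R_def A_def B_def)
qed

text \<open>
  Let \<open>a = c1 + c2\<close>, \<open>b = c3 + c4\<close>, so \<open>b < a\<close>. For \<open>y < b^2\<close> both sides vanish. For \<open>a^2 < y\<close>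
  the two integrals run over the two ovals of one elliptic curve and \<open>ellK_two_ovals\<close> applies. For
  \<open>b^2 < y < a^2\<close> translation by the rational 2-torsion point of this curve, in these
  coordinates \<open>u \<mapsto> C / u - 1\<close>, carries one integral into the other.
\<close>

lemma fibre_periods_eq:
  fixes c1 c2 c3 c4 y :: real
  assumes ord: "c1 > c2" "c1 > c3" "c2 > c4" "c3 > c4" "c4 > 0"
    and y: "y > 0" "y \<noteq> (c1 + c2)\<^sup>2" "y \<noteq> (c3 + c4)\<^sup>2"
  defines "d1 \<equiv> (c1 + c2 + c3 + c4)\<^sup>2 / 4" and "d2 \<equiv> (c1 + c2) * (c3 + c4)"
    and "d3 \<equiv> (c1 + c3) * (c2 + c4)" and "d4 \<equiv> 2 * (c1 * c4 + c2 * c3)"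
  shows "(\<integral>\<^sup>+u\<in>{u. 0 < u \<and> (c3\<^sup>2 + c1\<^sup>2 * u) + (c4\<^sup>2 + c2\<^sup>2 * u) < (1 + u) * y}.
           inv_sqrt (u * (((1 + u) * y - (c3\<^sup>2 + c1\<^sup>2 * u) - (c4\<^sup>2 + c2\<^sup>2 * u))\<^sup>2
                 - 4 * (c3\<^sup>2 + c1\<^sup>2 * u) * (c4\<^sup>2 + c2\<^sup>2 * u))) \<partial>lborel) =
         (\<integral>\<^sup>+u\<in>{0<..}. inv_sqrt ((1 + u) * (4 * (d3 + d1 * u) * u * y - (u * y + (d4 + d2 * u))\<^sup>2)) \<partial>lborel)"
    (is "?L = ?R")
proof -
  define a b a' b' where "a = c1 + c2" and "b = c3 + c4" and "a' = c1 - c2" and "b' = c3 - c4"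
  have ab: "0 < b" "b < a" "0 < b'" "b' < b" "0 < a'" using ord by (auto simp: a_def b_def b'_def a'_def)
  have sq: "b\<^sup>2 < a\<^sup>2" "b'\<^sup>2 < b\<^sup>2" using ab by (auto intro!: power_strict_mono)
  define q0 q1 r0 r1 M where "q0 = (y - a\<^sup>2) * (y - a'\<^sup>2)" and "q1 = (y - b\<^sup>2) * (y - b'\<^sup>2)"
    and "r0 = (y - a\<^sup>2) * (y - b\<^sup>2)" and "r1 = (y - a'\<^sup>2) * (y - b'\<^sup>2)"
    and "M = 2 * y\<^sup>2 - (a\<^sup>2 + a'\<^sup>2 + b\<^sup>2 + b'\<^sup>2) * y + 2 * a * a' * b * b'"
  note defs = q0_def q1_def r0_def r1_def M_def a_def b_def a'_def b'_def
  define A B where "A u = c3\<^sup>2 + c1\<^sup>2 * u" and "B u = c4\<^sup>2 + c2\<^sup>2 * u" for u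
  have Q: "((1 + u) * y - A u - B u)\<^sup>2 - 4 * A u * B u = q0 * u\<^sup>2 + M * u + q1" for u
    unfolding defs A_def B_def by algebra
  have "4 * d1 = (c1 + c2 + c3 + c4)\<^sup>2" by (simp add: d1_def)
  hence oval: "4 * (d3 + d1 * u) * u * y - (u * y + (d4 + d2 * u))\<^sup>2 = M * (1 + u) - r0 * (1 + u)\<^sup>2 - r1" for u
    unfolding defs d2_def d3_def d4_def by algebra
  have prod: "q0 * q1 = r0 * r1" unfolding defs by algebra
  have one: "r0 - M + r1 = (2 * (c1 * c4 + c2 * c3))\<^sup>2" unfolding defs by algebra
  have one0: "0 \<le> r0 - M + r1" unfolding one by simp
  have Mr: "M - 2 * r0 = 4 * (c1 * c2 + c3 * c4) * y - 4 * (c1 + c2) * (c3 + c4) * (c1 * c4 + c2 * c3)"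
    unfolding defs by algebra
  have disc: "M\<^sup>2 - 4 * (q0 * q1) = 16 * y * ((c1\<^sup>2 - c3\<^sup>2) * (c2\<^sup>2 - c4\<^sup>2) * (y - a\<^sup>2)
      + (c2 * (c1\<^sup>2 - c3\<^sup>2) + c1 * (c2\<^sup>2 - c4\<^sup>2))\<^sup>2)"
    unfolding defs by algebra
  have diffs: "0 < c1\<^sup>2 - c3\<^sup>2" "0 < c2\<^sup>2 - c4\<^sup>2" using ord by (auto intro!: power_strict_mono)
  \<comment> \<open>A positive radicand keeps \<open>(1 + u) y - A u - B u\<close> away from 0, by the Cauchy-Schwarz inequality
     \<open>A u B u \<ge> (c1 c2 u + c3 c4)^2\<close>. Therefore the condition \<open>A u + B u < (1 + u) y\<close> may be
     replaced by any linear condition that differs from it by at most this margin.\<close>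
  have sep: "2 * (c1 * c2 * u + c3 * c4) < \<bar>(1 + u) * y - A u - B u\<bar>"
    if "u > 0" "0 < q0 * u\<^sup>2 + M * u + q1" for u
  proof -
    have "A u * B u - (c1 * c2 * u + c3 * c4)\<^sup>2 = u * (c1 * c4 - c2 * c3)\<^sup>2"
      unfolding A_def B_def by algebra
    moreover have "u * (c1 * c4 - c2 * c3)\<^sup>2 \<ge> 0" using that by simp
    ultimately have "4 * (c1 * c2 * u + c3 * c4)\<^sup>2 < ((1 + u) * y - A u - B u)\<^sup>2"
      using Q[of u] that by linarith
    hence "(2 * (c1 * c2 * u + c3 * c4))\<^sup>2 < ((1 + u) * y - A u - B u)\<^sup>2"
      unfolding power_mult_distrib by simp
    thus ?thesis
      using abs_le_square_iff[of "(1 + u) * y - A u - B u" "2 * (c1 * c2 * u + c3 * c4)"] by linarith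
  qed
  have L: "?L = (\<integral>\<^sup>+u\<in>{u. 0 < u \<and> A u + B u < (1 + u) * y}. inv_sqrt (u * (q0 * u\<^sup>2 + M * u + q1)) \<partial>lborel)"
    unfolding Q[symmetric] A_def B_def ..
  have R: "?R = (\<integral>\<^sup>+u\<in>{0<..}. inv_sqrt ((1 + u) * (M * (1 + u) - r0 * (1 + u)\<^sup>2 - r1)) \<partial>lborel)"
    unfolding oval ..
  consider "y < b\<^sup>2" | "b\<^sup>2 < y" "y < a\<^sup>2" | "a\<^sup>2 < y"
    using y by (fold a_def b_def) linarith
  thus ?thesis
  proof cases
    case 1
    have "inv_sqrt (u * (q0 * u\<^sup>2 + M * u + q1)) = 0" if "0 < u" "A u + B u < (1 + u) * y" for u
    proof (rule inv_sqrt_nonpos, rule ccontr)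
      assume "\<not> u * (q0 * u\<^sup>2 + M * u + q1) \<le> 0"
      hence "0 < q0 * u\<^sup>2 + M * u + q1" using that by (simp add: not_le zero_less_mult_iff)
      hence "2 * (c1 * c2 * u + c3 * c4) < (1 + u) * y - A u - B u"
        using sep[of u] that by simp
      moreover have "A u + B u + 2 * (c1 * c2 * u + c3 * c4) = a\<^sup>2 * u + b\<^sup>2"
        unfolding A_def B_def a_def b_def by algebra
      ultimately have "a\<^sup>2 * u + b\<^sup>2 < (1 + u) * y" by linarith
      moreover have "(1 + u) * y \<le> a\<^sup>2 * u + b\<^sup>2"
      proof -
        have "u * y \<le> u * a\<^sup>2" using that 1 sq by (intro mult_left_mono) auto
        thus ?thesis using 1 by (simp add: algebra_simps)
      qed
      ultimately show False by simp
    qed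
    hence "?L = 0"
      unfolding L by (intro nn_integral_0_iff_AE[THEN iffD2]) (auto simp: indicator_def A_def B_def)
    have r0: "r0 > 0" unfolding r0_def using 1 sq by (simp add: mult_neg_neg)
    have "M < 2 * r0"
    proof -
      have "(c1 * c2 + c3 * c4) * y < (c1 * c2 + c3 * c4) * b\<^sup>2"
        using 1 ord by (intro mult_strict_left_mono) (auto intro!: add_pos_pos)
      moreover have "(c1 + c2) * (c3 + c4) * (c1 * c4 + c2 * c3) - (c1 * c2 + c3 * c4) * b\<^sup>2
          = b * (c4 * (c1\<^sup>2 - c3\<^sup>2) + c3 * (c2\<^sup>2 - c4\<^sup>2))"
        unfolding b_def by algebra
      moreover have "b * (c4 * (c1\<^sup>2 - c3\<^sup>2) + c3 * (c2\<^sup>2 - c4\<^sup>2)) > 0"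
        using ab ord diffs by (intro mult_pos_pos add_pos_pos) auto
      ultimately show ?thesis using Mr by linarith
    qed
    hence "inv_sqrt ((1 + u) * (M * (1 + u) - r0 * (1 + u)\<^sup>2 - r1)) = 0" if "u > 0" for u
    proof -
      have "M * (1 + u) - r0 * (1 + u)\<^sup>2 - r1 = - (r0 * u\<^sup>2 + (2 * r0 - M) * u + (r0 - M + r1))"
        by algebra
      moreover have "r0 * u\<^sup>2 \<ge> 0" "(2 * r0 - M) * u \<ge> 0"
        using that r0 \<open>M < 2 * r0\<close> by auto
      ultimately have "M * (1 + u) - r0 * (1 + u)\<^sup>2 - r1 \<le> 0" using one0 by linarith
      thus ?thesis using that by (intro inv_sqrt_nonpos mult_nonneg_nonpos) auto
    qed
    hence "?R = 0"
      unfolding R by (intro nn_integral_0_iff_AE[THEN iffD2]) (auto simp: indicator_def)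
    with \<open>?L = 0\<close> show ?thesis by simp
  next
    case 2
    \<comment> \<open>The constant that satisfies \<open>q1 = - r0 C\<close> and \<open>r1 = - q0 C\<close>.\<close>
    define C where "C = (y - b'\<^sup>2) / (a\<^sup>2 - y)"
    have C: "C > 0" "C * (a\<^sup>2 - y) = y - b'\<^sup>2" using 2 sq by (auto simp: C_def)
    have qr: "q1 = - r0 * C" "r1 = - q0 * C"
      using C(2) unfolding q0_def q1_def r0_def r1_def by algebra+
    have "?L = (\<integral>\<^sup>+u\<in>{0<..<C}. inv_sqrt (u * (q0 * u\<^sup>2 + M * u + q1)) \<partial>lborel)"
      unfolding L
    proof (intro nn_integral_cong)
      fix u :: real
      have "A u + B u < (1 + u) * y \<longleftrightarrow> u < C" if u: "u > 0" and pos: "0 < q0 * u\<^sup>2 + M * u + q1"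
      proof -
        have "u < C \<longleftrightarrow> u * (a\<^sup>2 - y) < y - b'\<^sup>2"
          using 2 by (simp add: C_def pos_less_divide_eq)
        also have "\<dots> \<longleftrightarrow> 2 * c1 * c2 * u - 2 * c3 * c4 < (1 + u) * y - A u - B u"
        proof -
          have "(1 + u) * y - A u - B u - (2 * c1 * c2 * u - 2 * c3 * c4) = y - b'\<^sup>2 - u * (a\<^sup>2 - y)"
            unfolding A_def B_def a_def b'_def by algebra
          thus ?thesis by linarith
        qed
        \<comment> \<open>The shift \<open>2 c1 c2 u - 2 c3 c4\<close> is within the margin of \<open>sep\<close>.\<close>
        also have "\<dots> \<longleftrightarrow> A u + B u < (1 + u) * y"
        proof -
          have "c1 * c2 * u > 0" "c3 * c4 > 0" using u ord by auto
          thus ?thesis using sep[OF u pos] by (auto simp: abs_if split: if_splits)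
        qed
        finally show ?thesis ..
      qed
      moreover have "inv_sqrt (u * (q0 * u\<^sup>2 + M * u + q1)) = 0" if "u > 0" "\<not> 0 < q0 * u\<^sup>2 + M * u + q1"
        using that by (intro inv_sqrt_nonpos mult_nonneg_nonpos) auto
      ultimately show "inv_sqrt (u * (q0 * u\<^sup>2 + M * u + q1)) * indicator {u. 0 < u \<and> A u + B u < (1 + u) * y} u
          = inv_sqrt (u * (q0 * u\<^sup>2 + M * u + q1)) * indicator {0<..<C} u"
        by (cases "0 < u"; cases "0 < q0 * u\<^sup>2 + M * u + q1") (auto simp: indicator_def)
    qed
    also have "\<dots> = ?R" unfolding R
    proof (rule nn_integral_inv_sqrt_substitution[symmetric, where g = "\<lambda>u. C / u - 1" and h = "\<lambda>v. C / (1 + v)"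
          and g' = "\<lambda>u. - C / u\<^sup>2"])
      fix u assume "u \<in> {0<..<C}"
      hence u: "0 < u" "u < C" by auto
      show "C / u - 1 \<in> {0<..} \<and> C / (1 + (C / u - 1)) = u" using u C by simp
      show "((\<lambda>u. C / u - 1) has_real_derivative - C / u\<^sup>2) (at u)"
        using u by (auto intro!: derivative_eq_intros simp: power2_eq_square)
      have "u ^ 3 * ((C / u) * (M * (C / u) - r0 * (C / u)\<^sup>2 - r1)) = C * (M * C * u - r0 * C\<^sup>2 - r1 * u\<^sup>2)"
        using u by (simp add: field_simps power2_eq_square power3_eq_cube)
      also have "\<dots> = C\<^sup>2 * (q0 * u\<^sup>2 + M * u + q1)" unfolding qr by algebra
      also have "\<dots> = u ^ 3 * ((C / u\<^sup>2)\<^sup>2 * (u * (q0 * u\<^sup>2 + M * u + q1)))"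
        using u by (simp add: field_simps power2_eq_square power3_eq_cube)
      finally have "(C / u) * (M * (C / u) - r0 * (C / u)\<^sup>2 - r1) = (C / u\<^sup>2)\<^sup>2 * (u * (q0 * u\<^sup>2 + M * u + q1))"
        using u by (subst (asm) mult_cancel_left) simp
      thus "- C / u\<^sup>2 \<noteq> 0 \<and> (1 + (C / u - 1)) * (M * (1 + (C / u - 1)) - r0 * (1 + (C / u - 1))\<^sup>2 - r1)
          = (- C / u\<^sup>2)\<^sup>2 * (u * (q0 * u\<^sup>2 + M * u + q1))"
        using u C by simp
    next
      fix v :: real assume "v \<in> {0<..}"
      thus "C / (1 + v) \<in> {0<..<C} \<and> C / (C / (1 + v)) - 1 = v" using C by (simp add: divide_less_eq)
    qed measurable
    finally show ?thesis .
  next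
    case 3
    have "a'\<^sup>2 < a\<^sup>2" using ord by (auto simp: a_def a'_def intro!: power_strict_mono)
    hence pos: "q0 > 0" "q1 > 0" "r0 > 0" unfolding q0_def q1_def r0_def using 3 sq by auto
    have M: "2 * r0 < M"
    proof -
      have "(c1 * c2 + c3 * c4) * a\<^sup>2 < (c1 * c2 + c3 * c4) * y"
        using 3 ord by (intro mult_strict_left_mono) (auto intro!: add_pos_pos)
      moreover have "(c1 * c2 + c3 * c4) * a\<^sup>2 - (c1 + c2) * (c3 + c4) * (c1 * c4 + c2 * c3)
          = a * (c1 * (c2\<^sup>2 - c4\<^sup>2) + c2 * (c1\<^sup>2 - c3\<^sup>2))"
        unfolding a_def by algebra
      moreover have "a * (c1 * (c2\<^sup>2 - c4\<^sup>2) + c2 * (c1\<^sup>2 - c3\<^sup>2)) > 0"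
        using ab ord diffs by (intro mult_pos_pos add_pos_pos) auto
      ultimately show ?thesis using Mr by linarith
    qed
    have "0 < 16 * y * ((c1\<^sup>2 - c3\<^sup>2) * (c2\<^sup>2 - c4\<^sup>2) * (y - a\<^sup>2)
      + (c2 * (c1\<^sup>2 - c3\<^sup>2) + c1 * (c2\<^sup>2 - c4\<^sup>2))\<^sup>2)"
      using y diffs 3 by (intro mult_pos_pos add_pos_nonneg) auto
    hence D: "4 * (q0 * q1) < M\<^sup>2" using disc by linarith
    have "?L = (\<integral>\<^sup>+u\<in>{0<..}. inv_sqrt (u * (q0 * u\<^sup>2 + M * u + q1)) \<partial>lborel)"
      unfolding L
    proof (intro nn_integral_cong)
      fix u :: real
      have "A u + B u < (1 + u) * y" if "u > 0"
      proof -
        have "a\<^sup>2 * u + b\<^sup>2 < (1 + u) * y"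
        proof -
          have "u * a\<^sup>2 < u * y" using that 3 by (intro mult_strict_left_mono) auto
          thus ?thesis using 3 sq by (simp add: algebra_simps)
        qed
        moreover have "a\<^sup>2 * u + b\<^sup>2 = A u + B u + 2 * (c1 * c2 * u + c3 * c4)"
          unfolding A_def B_def a_def b_def by algebra
        moreover have "2 * (c1 * c2 * u + c3 * c4) > 0"
          using that ord by (auto intro!: add_pos_pos)
        ultimately show ?thesis by (metis add_less_cancel_left add.right_neutral less_trans)
      qed
      thus "inv_sqrt (u * (q0 * u\<^sup>2 + M * u + q1)) * indicator {u. 0 < u \<and> A u + B u < (1 + u) * y} u
          = inv_sqrt (u * (q0 * u\<^sup>2 + M * u + q1)) * indicator {0<..} u"
        by (auto simp: indicator_def)
    qed
    also have "\<dots> = ?R"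
      unfolding R by (rule ellK_two_ovals[OF pos prod D M one0])
    finally show ?thesis .
  qed
qed

text \<open>
  At the point on the right-hand side, \<open>4 A = (a + b)^2 (1 + u) - (a' + b')^2\<close> and
  \<open>B = a b (1 + u) - a' b'\<close> with \<open>a, a' = c1 \<plusminus> c2\<close> and \<open>b, b' = c3 \<plusminus> c4\<close>. This shape makes the leading and
  the constant coefficient of the radicand of \<open>ellK_oval\<close>, as a polynomial in \<open>1 + u\<close>, up to sign products of
  the same four factors \<open>x^2 - a^2\<close>, \<open>x^2 - a'^2\<close>, \<open>x^2 - b^2\<close>, \<open>x^2 - b'^2\<close> that occur in the
  radicand of \<open>ellK_Heron\<close> at the squares \<open>c_i^2\<close>.
\<close>

lemma double_period_duplication:
  fixes c1 c2 c3 c4 :: real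
  assumes ord: "c1 > c2" "c1 > c3" "c2 > c4" "c3 > c4" "c4 > 0"
  shows "double_period (c1\<^sup>2) (c2\<^sup>2) (c3\<^sup>2) (c4\<^sup>2) =
     2 * double_period ((c1 + c2 + c3 + c4)\<^sup>2 / 4) ((c1 + c2) * (c3 + c4)) ((c1 + c3) * (c2 + c4)) (2 * (c1 * c4 + c2 * c3))"
proof -
  have c: "c1 > 0" "c2 > 0" "c3 > 0" using ord by auto
  have e: "(c1 + c3) * (c2 + c4) - 2 * (c1 * c4 + c2 * c3) = (c1 - c3) * (c2 - c4)"
          "(c1 + c2 + c3 + c4)\<^sup>2 / 4 - (c1 + c2) * (c3 + c4) = (c1 + c2 - c3 - c4)\<^sup>2 / 4"
    by (simp_all add: power2_eq_square field_simps)
  have "(c1 - c3) * (c2 - c4) > 0" "(c1 + c2 - c3 - c4)\<^sup>2 / 4 > 0" using ord by auto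
  hence lt: "2 * (c1 * c4 + c2 * c3) < (c1 + c3) * (c2 + c4)" "(c1 + c2) * (c3 + c4) < (c1 + c2 + c3 + c4)\<^sup>2 / 4"
    unfolding e[symmetric] by auto
  have pos: "0 < (c1 + c2) * (c3 + c4)" "0 < 2 * (c1 * c4 + c2 * c3)"
    using c ord by (auto intro!: add_pos_pos)
  have ae: "AE x in lborel. x \<noteq> c1 + c2 \<and> x \<noteq> c3 + c4"
    using AE_lborel_singleton[of "c1 + c2"] AE_lborel_singleton[of "c3 + c4"] by eventually_elim auto
  let ?P = "\<lambda>x. (\<integral>\<^sup>+u\<in>{u. 0 < u \<and> (c3\<^sup>2 + c1\<^sup>2 * u) + (c4\<^sup>2 + c2\<^sup>2 * u) < (1 + u) * x\<^sup>2}.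
           inv_sqrt (u * (((1 + u) * x\<^sup>2 - (c3\<^sup>2 + c1\<^sup>2 * u) - (c4\<^sup>2 + c2\<^sup>2 * u))\<^sup>2
                 - 4 * (c3\<^sup>2 + c1\<^sup>2 * u) * (c4\<^sup>2 + c2\<^sup>2 * u))) \<partial>lborel)"
  let ?P' = "\<lambda>x. (\<integral>\<^sup>+u\<in>{0<..}. inv_sqrt ((1 + u) * (4 * ((c1 + c3) * (c2 + c4) + (c1 + c2 + c3 + c4)\<^sup>2 / 4 * u) * u * x\<^sup>2
           - (u * x\<^sup>2 + (2 * (c1 * c4 + c2 * c3) + (c1 + c2) * (c3 + c4) * u))\<^sup>2)) \<partial>lborel)"
  have "double_period (c1\<^sup>2) (c2\<^sup>2) (c3\<^sup>2) (c4\<^sup>2) = 4 * (\<integral>\<^sup>+x\<in>{0<..}. ?P x \<partial>lborel)"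
    using c ord by (intro double_period_by_Heron) auto
  also have "(\<integral>\<^sup>+x\<in>{0<..}. ?P x \<partial>lborel) = (\<integral>\<^sup>+x\<in>{0<..}. ?P' x \<partial>lborel)"
  proof (rule nn_integral_cong_AE)
    show "AE x in lborel. ?P x * indicator {0<..} x = ?P' x * indicator {0<..} x"
      using ae
    proof eventually_elim
      case (elim x)
      show ?case
      proof (cases "x > 0")
        case True
        have "x\<^sup>2 \<noteq> (c1 + c2)\<^sup>2" "x\<^sup>2 \<noteq> (c3 + c4)\<^sup>2"
          using elim True c ord by (auto simp: power2_eq_iff)
        hence "?P x = ?P' x"
          using True by (intro fibre_periods_eq ord) auto
        thus ?thesis by simp
      qed simp
    qed
  qed
  also have "4 * \<dots> = 2 * (2 * (\<integral>\<^sup>+x\<in>{0<..}. ?P' x \<partial>lborel))"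
    by (simp flip: mult.assoc)
  also have "2 * (\<integral>\<^sup>+x\<in>{0<..}. ?P' x \<partial>lborel) = double_period ((c1 + c2 + c3 + c4)\<^sup>2 / 4)
      ((c1 + c2) * (c3 + c4)) ((c1 + c3) * (c2 + c4)) (2 * (c1 * c4 + c2 * c3))"
    using c ord pos lt by (intro double_period_by_oval[symmetric]) auto
  finally show ?thesis .
qed

section \<open>The Euler integral of a triangular matrix\<close>

text \<open>
  The Euler integral without the factor \<open>1 / \<pi>^2\<close>, for a real matrix whose linear factors are
  nonnegative on the unit square.
\<close>

definition Euler_period :: "real \<Rightarrow> real \<Rightarrow> real \<Rightarrow> real \<Rightarrow> ennreal" where
  "Euler_period z1 z2 z3 z4 = (\<integral>\<^sup>+s1\<in>{0<..<1}. (\<integral>\<^sup>+s2\<in>{0<..<1}.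
     inv_sqrt (s1 * (1 - s1) * s2 * (1 - s2) * (1 - z1 * s1 - z2 * s2) * (1 - z3 * s1 - z4 * s2)) \<partial>lborel) \<partial>lborel)"

text \<open>
  Under \<open>s1 = u / (k + u)\<close>, \<open>s2 = r / (1 + r)\<close> the second linear factor becomes a multiple of
  \<open>d3 + d1 u + d4 r + d2 u r\<close> divided by \<open>(k + u) (1 + r)\<close>, where the coefficient of \<open>u r\<close> comes out right
  because of \<open>k (d1 - d2) = d3 - d4\<close>; the denominators cancel against the Jacobian.
\<close>

lemma Euler_period_triangular:
  assumes d: "d1 > 0" "d2 > 0" "d3 > 0" "d4 > 0" and k: "k > 0" "k * (d1 - d2) = d3 - d4"
  shows "Euler_period (1 - k) 0 (1 - k * d1 / d3) (1 - d4 / d3) = ennreal (sqrt (d3 / k)) * double_period d1 d2 d3 d4"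
proof -
  define z1 z3 z4 where "z1 = 1 - k" and "z3 = 1 - k * d1 / d3" and "z4 = 1 - d4 / d3"
  have "Euler_period z1 0 z3 z4 = (\<integral>\<^sup>+s\<in>{0<..<1}. (\<integral>\<^sup>+r\<in>{0<..}.
      inv_sqrt (s * (1 - s) * (1 - z1 * s) * (r * (1 + r)) * ((1 - z3 * s) * (1 + r) - z4 * r)) \<partial>lborel) \<partial>lborel)"
    unfolding Euler_period_def
  proof (rule nn_integral_cong, rule arg_cong2[where f = "(*)", OF _ refl])
    fix s :: real
    show "(\<integral>\<^sup>+t\<in>{0<..<1}. inv_sqrt (s * (1 - s) * t * (1 - t) * (1 - z1 * s - 0 * t) * (1 - z3 * s - z4 * t)) \<partial>lborel)
      = (\<integral>\<^sup>+r\<in>{0<..}. inv_sqrt (s * (1 - s) * (1 - z1 * s) * (r * (1 + r)) * ((1 - z3 * s) * (1 + r) - z4 * r)) \<partial>lborel)"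
    proof (rule nn_integral_inv_sqrt_substitution[where g = "\<lambda>r. r / (1 + r)" and h = "\<lambda>t. t / (1 - t)" and g' = "\<lambda>r. 1 / (1 + r)\<^sup>2"])
      fix r :: real assume "r \<in> {0<..}"
      hence r: "r > 0" by simp
      show "r / (1 + r) \<in> {0<..<1} \<and> (r / (1 + r)) / (1 - r / (1 + r)) = r"
        using r by (simp add: field_simps)
      show "((\<lambda>r. r / (1 + r)) has_real_derivative 1 / (1 + r)\<^sup>2) (at r)"
        using r by (auto intro!: derivative_eq_intros simp: power2_eq_square)
      have e: "1 - r / (1 + r) = 1 / (1 + r)"
        "1 - z3 * s - z4 * (r / (1 + r)) = ((1 - z3 * s) * (1 + r) - z4 * r) / (1 + r)"
        using r by (simp_all add: field_simps)
      show "1 / (1 + r)\<^sup>2 \<noteq> 0 \<and> s * (1 - s) * (r / (1 + r)) * (1 - r / (1 + r)) * (1 - z1 * s - 0 * (r / (1 + r))) *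
           (1 - z3 * s - z4 * (r / (1 + r))) =
         (1 / (1 + r)\<^sup>2)\<^sup>2 * (s * (1 - s) * (1 - z1 * s) * (r * (1 + r)) * ((1 - z3 * s) * (1 + r) - z4 * r))"
        unfolding e using r by (simp add: power2_eq_square mult_ac)
    next
      fix t :: real assume "t \<in> {0<..<1}"
      thus "t / (1 - t) \<in> {0<..} \<and> (t / (1 - t)) / (1 + t / (1 - t)) = t" by (simp add: field_simps)
    qed measurable
  qed
  also have "\<dots> = (\<integral>\<^sup>+r\<in>{0<..}. (\<integral>\<^sup>+s\<in>{0<..<1}.
      inv_sqrt (s * (1 - s) * (1 - z1 * s) * (r * (1 + r)) * ((1 - z3 * s) * (1 + r) - z4 * r)) \<partial>lborel) \<partial>lborel)"
    by (rule nn_integral_swap_indicator) auto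
  also have "\<dots> = (\<integral>\<^sup>+r\<in>{0<..}. (\<integral>\<^sup>+u\<in>{0<..}.
      inv_sqrt (k / d3 * (u * (1 + u) * r * (1 + r) * (d3 + d1 * u + d4 * r + d2 * u * r))) \<partial>lborel) \<partial>lborel)"
  proof (rule nn_integral_cong, rule arg_cong2[where f = "(*)", OF _ refl])
    fix r :: real
    show "(\<integral>\<^sup>+s\<in>{0<..<1}. inv_sqrt (s * (1 - s) * (1 - z1 * s) * (r * (1 + r)) * ((1 - z3 * s) * (1 + r) - z4 * r)) \<partial>lborel)
      = (\<integral>\<^sup>+u\<in>{0<..}. inv_sqrt (k / d3 * (u * (1 + u) * r * (1 + r) * (d3 + d1 * u + d4 * r + d2 * u * r))) \<partial>lborel)"
    proof (rule nn_integral_inv_sqrt_substitution[where g = "\<lambda>u. u / (k + u)" and h = "\<lambda>s. k * s / (1 - s)" and g' = "\<lambda>u. k / (k + u)\<^sup>2"])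
      fix u :: real assume "u \<in> {0<..}"
      hence u: "u > 0" "k + u > 0" using k by auto
      show "((\<lambda>u. u / (k + u)) has_real_derivative k / (k + u)\<^sup>2) (at u)"
        using u by (auto intro!: derivative_eq_intros simp: power2_eq_square)
      have e: "1 - u / (k + u) = k / (k + u)" "1 - z1 * (u / (k + u)) = k * (1 + u) / (k + u)"
        using u by (simp_all add: z1_def field_simps)
      show "u / (k + u) \<in> {0<..<1} \<and> k * (u / (k + u)) / (1 - u / (k + u)) = u"
        unfolding e using u k by simp
      have "d3 * z3 = d3 - k * d1" "d3 * z4 = d3 - d4" "(k + u) * (u / (k + u)) = u"
        using d u by (simp_all add: z3_def z4_def field_simps)
      hence "d3 * (k + u) * ((1 - z3 * (u / (k + u))) * (1 + r) - z4 * r)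
          = (d3 * (k + u) - (d3 - k * d1) * u) * (1 + r) - (d3 - d4) * (k + u) * r"
        by algebra
      also have "\<dots> = k * (d3 + d1 * u + d4 * r + d2 * u * r)"
        using k(2) by algebra
      finally have e3: "(1 - z3 * (u / (k + u))) * (1 + r) - z4 * r = k * (d3 + d1 * u + d4 * r + d2 * u * r) / (d3 * (k + u))"
        using u d by (simp add: nonzero_eq_divide_eq mult.commute)
      show "k / (k + u)\<^sup>2 \<noteq> 0 \<and>
         u / (k + u) * (1 - u / (k + u)) * (1 - z1 * (u / (k + u))) * (r * (1 + r)) *
         ((1 - z3 * (u / (k + u))) * (1 + r) - z4 * r) =
         (k / (k + u)\<^sup>2)\<^sup>2 * (k / d3 * (u * (1 + u) * r * (1 + r) * (d3 + d1 * u + d4 * r + d2 * u * r)))"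
        unfolding e e3 using u k by (simp add: power2_eq_square mult_ac)
    next
      fix s :: real assume s: "s \<in> {0<..<1}"
      hence "k + k * s / (1 - s) = k / (1 - s)" by (simp add: field_simps)
      thus "k * s / (1 - s) \<in> {0<..} \<and> (k * s / (1 - s)) / (k + k * s / (1 - s)) = s"
        using s k by simp
    qed measurable
  qed
  also have "\<dots> = (\<integral>\<^sup>+u\<in>{0<..}. (\<integral>\<^sup>+r\<in>{0<..}.
      inv_sqrt (k / d3 * (u * (1 + u) * r * (1 + r) * (d3 + d1 * u + d4 * r + d2 * u * r))) \<partial>lborel) \<partial>lborel)"
    by (rule nn_integral_swap_indicator) auto
  also have "\<dots> = (\<integral>\<^sup>+u\<in>{0<..}. (\<integral>\<^sup>+r\<in>{0<..}. ennreal (sqrt (d3 / k)) *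
      inv_sqrt (u * (1 + u) * r * (1 + r) * (d3 + d1 * u + d4 * r + d2 * u * r)) \<partial>lborel) \<partial>lborel)"
    using d k by (subst inv_sqrt_mult) (auto simp: inv_sqrt_def[of "k / d3"] real_sqrt_divide)
  also have "\<dots> = ennreal (sqrt (d3 / k)) * double_period d1 d2 d3 d4"
    unfolding double_period_def by (simp add: mult.assoc nn_integral_cmult)
  finally show ?thesis by (simp add: z1_def z3_def z4_def)
qed

section \<open>The series equals the Euler integral\<close>

text \<open>
  The coefficient of \<open>a^i b^j\<close> in \<open>(1 - a - b) powr (-1/2)\<close>.
\<close>

definition half_coeff :: "nat \<times> nat \<Rightarrow> real" where
  "half_coeff = (\<lambda>(i, j). pochhammer (1/2) (i + j) / (fact i * fact j))"

lemma pochhammer_half_pos: "pochhammer (1/2 :: real) n > 0"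
  by (rule pochhammer_pos) simp

lemma half_coeff_nonneg: "half_coeff ij \<ge> 0"
  by (cases ij) (auto simp: half_coeff_def less_imp_le[OF pochhammer_half_pos])

lemma pochhammer_half_le_fact: "pochhammer (1/2 :: real) n \<le> fact n"
proof (induction n)
  case (Suc n)
  have "pochhammer (1/2 :: real) (Suc n) = (1/2 + real n) * pochhammer (1/2) n"
    by (simp add: pochhammer_Suc)
  also have "\<dots> \<le> (1 + real n) * fact n"
    using Suc pochhammer_half_pos[of n] by (intro mult_mono) auto
  finally show ?case by simp
qed simp

lemma binomial_half_sums:
  fixes w :: complex
  assumes "norm w < 1"
  shows "(\<lambda>n. of_real (pochhammer (1/2) n / fact n) * w ^ n) sums (1 / csqrt (1 - w))"
proof -
  have "1 - w \<noteq> 0" using assms by auto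
  have "(\<lambda>n. ((-1/2) gchoose n) * (-w) ^ n) sums (1 + (-w)) powr (-1/2)"
    using assms by (intro gen_binomial_complex) auto
  also have "(1 + (-w)) powr (-1/2) = 1 / csqrt (1 - w)"
    using \<open>1 - w \<noteq> 0\<close> by (simp add: csqrt_conv_powr powr_minus_divide)
  also have "(\<lambda>n. ((-1/2) gchoose n) * (-w) ^ n) = (\<lambda>n. of_real (pochhammer (1/2) n / fact n) * w ^ n)"
  proof
    fix n
    have "(-w) ^ n = (-1) ^ n * w ^ n" by (rule power_minus)
    moreover have "pochhammer (1/2 :: complex) n = of_real (pochhammer (1/2) n)"
      by (simp flip: pochhammer_of_real)
    ultimately show "((-1/2) gchoose n) * (-w) ^ n = of_real (pochhammer (1/2) n / fact n) * w ^ n"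
      by (simp add: gbinomial_pochhammer flip: power_mult_distrib)
  qed
  finally show ?thesis .
qed

text \<open>
  Summed along a diagonal, the double series becomes the binomial series in \<open>a + b\<close>.
\<close>

lemma half_coeff_diagonal:
  fixes a b :: "'a :: {real_normed_field}"
  shows "(\<Sum>i\<le>N. of_real (half_coeff (i, N - i)) * a ^ i * b ^ (N - i)) =
         of_real (pochhammer (1/2) N / fact N) * (a + b) ^ N"
proof -
  have "of_real (half_coeff (i, N - i)) * a ^ i * b ^ (N - i) =
      of_real (pochhammer (1/2) N / fact N) * (of_nat (N choose i) * a ^ i * b ^ (N - i))" if "i \<le> N" for i
    using that by (simp add: half_coeff_def binomial_fact)
  thus ?thesis by (simp add: binomial_ring sum_distrib_left)
qed

lemma half_coeff_summable:
  fixes x y :: real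
  assumes "x \<ge> 0" "y \<ge> 0" "x + y < 1"
  shows "(\<lambda>(i, j). half_coeff (i, j) * x ^ i * y ^ j) summable_on UNIV"
proof -
  have "(\<lambda>(N, i). half_coeff (i, N - i) * x ^ i * y ^ (N - i)) summable_on (SIGMA N:UNIV. {..N})"
  proof (rule summable_on_SigmaI)
    fix N :: nat
    show "((\<lambda>i. case (N, i) of (N, i) \<Rightarrow> half_coeff (i, N - i) * x ^ i * y ^ (N - i)) has_sum
        pochhammer (1/2) N / fact N * (x + y) ^ N) {..N}"
      using half_coeff_diagonal[of N x y] by (intro has_sum_finiteI) auto
  next
    have "summable (\<lambda>N. pochhammer (1/2) N / fact N * (x + y) ^ N)"
    proof (rule summable_comparison_test')
      show "summable (\<lambda>N. (x + y) ^ N)" using assms by (intro summable_geometric) auto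
      fix N :: nat
      show "norm (pochhammer (1/2) N / fact N * (x + y) ^ N) \<le> (x + y) ^ N"
        using assms pochhammer_half_le_fact[of N] pochhammer_half_pos[of N]
          mult_right_mono[of "pochhammer (1/2) N / fact N" 1 "(x + y) ^ N"] by (simp add: abs_mult)
    qed
    thus "(\<lambda>N. pochhammer (1/2) N / fact N * (x + y) ^ N) summable_on UNIV"
      using assms pochhammer_half_pos by (subst summable_on_UNIV_nonneg_real_iff) (auto intro!: mult_nonneg_nonneg simp: less_imp_le)
  qed (use assms half_coeff_nonneg in auto)
  also have "?this \<longleftrightarrow> ?thesis"
    by (rule summable_on_reindex_bij_witness[where i = "\<lambda>(i, j). (i + j, i)" and j = "\<lambda>(N, i). (i, N - i)"]) auto
  finally show ?thesis .
qed

lemma half_coeff_abs_summable: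
  fixes a b :: complex
  assumes "norm a + norm b < 1"
  shows "(\<lambda>ij. norm (case ij of (i, j) \<Rightarrow> of_real (half_coeff (i, j)) * a ^ i * b ^ j)) summable_on UNIV"
  using half_coeff_summable[of "norm a" "norm b"] assms half_coeff_nonneg
  by (simp add: norm_mult norm_power case_prod_unfold)

lemma half_coeff_has_sum:
  fixes a b :: complex
  assumes "norm a + norm b < 1"
  shows "((\<lambda>(i, j). of_real (half_coeff (i, j)) * a ^ i * b ^ j) has_sum (1 / csqrt (1 - a - b))) UNIV"
proof -
  let ?f = "\<lambda>(i, j). of_real (half_coeff (i, j)) * a ^ i * b ^ j"
  have "?f summable_on UNIV" using half_coeff_abs_summable[OF assms] by (rule abs_summable_summable)
  then obtain S where S: "(?f has_sum S) UNIV" by (auto simp: summable_on_def)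
  also have "?this \<longleftrightarrow> ((\<lambda>(N, i). of_real (half_coeff (i, N - i)) * a ^ i * b ^ (N - i)) has_sum S) (SIGMA N:UNIV. {..N})"
    by (rule has_sum_reindex_bij_witness[where i = "\<lambda>(N, i). (i, N - i)" and j = "\<lambda>(i, j). (i + j, i)"]) auto
  finally have "((\<lambda>N. of_real (pochhammer (1/2) N / fact N) * (a + b) ^ N) has_sum S) UNIV"
    by (rule has_sum_SigmaD) (use half_coeff_diagonal[of _ a b] in \<open>auto intro!: has_sum_finiteI\<close>)
  hence "(\<lambda>N. of_real (pochhammer (1/2) N / fact N) * (a + b) ^ N) sums S"
    by (rule has_sum_imp_sums)
  moreover have "(\<lambda>N. of_real (pochhammer (1/2) N / fact N) * (a + b) ^ N) sums (1 / csqrt (1 - (a + b)))"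
    using assms norm_triangle_ineq[of a b] by (intro binomial_half_sums) auto
  ultimately have "S = 1 / csqrt (1 - (a + b))" by (rule sums_unique2)
  with S show ?thesis by (simp add: diff_diff_eq)
qed

lemma has_sum_times:
  fixes f :: "'a \<Rightarrow> complex" and g :: "'b \<Rightarrow> complex"
  assumes f: "(\<lambda>x. norm (f x)) summable_on UNIV" "(f has_sum S) UNIV" and g: "(\<lambda>y. norm (g y)) summable_on UNIV" "(g has_sum T) UNIV"
  shows "(\<lambda>p. norm (case p of (x, y) \<Rightarrow> f x * g y)) summable_on UNIV" "((\<lambda>(x, y). f x * g y) has_sum S * T) UNIV"
proof -
  have *: "(\<lambda>p. norm (case p of (x, y) \<Rightarrow> f x * g y)) summable_on (SIGMA x:UNIV. UNIV)"
    unfolding Infinite_Sum.abs_summable_on_Sigma_iff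
    using f g by (auto simp: norm_mult abs_mult infsum_cmult_right' intro!: summable_on_cmult_right summable_on_cmult_left)
  thus "(\<lambda>p. norm (case p of (x, y) \<Rightarrow> f x * g y)) summable_on UNIV" by simp
  from abs_summable_summable[OF *] obtain U where U: "((\<lambda>(x, y). f x * g y) has_sum U) (SIGMA x:UNIV. UNIV)"
    by (auto simp: summable_on_def)
  have "((\<lambda>x. f x * T) has_sum U) UNIV"
    by (rule has_sum_SigmaD[OF U]) (use g in \<open>auto intro!: has_sum_cmult_right\<close>)
  moreover have "((\<lambda>x. f x * T) has_sum S * T) UNIV" by (intro has_sum_cmult_left f)
  ultimately have "U = S * T" by (rule has_sum_unique)
  with U show "((\<lambda>(x, y). f x * g y) has_sum S * T) UNIV" by simp
qed

lemma nn_integral_Beta_half: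
  "(\<integral>\<^sup>+s\<in>{0..1}. ennreal (s ^ n / sqrt (s * (1 - s))) \<partial>lborel) = ennreal (pi * pochhammer (1/2) n / fact n)"
proof -
  have "((\<lambda>t. t powr (real n + 1/2 - 1) * (1 - t) powr (1/2 - 1)) has_integral Beta (real n + 1/2) (1/2)) {0..1}"
    by (rule has_integral_Beta_real) auto
  also have "?this \<longleftrightarrow> ((\<lambda>s. s ^ n / sqrt (s * (1 - s))) has_integral Beta (real n + 1/2) (1/2)) {0..1}"
  proof (rule has_integral_cong)
    fix t :: real assume t: "t \<in> {0..1}"
    show "t powr (real n + 1/2 - 1) * (1 - t) powr (1/2 - 1) = t ^ n / sqrt (t * (1 - t))"
    proof (cases "0 < t \<and> t < 1")
      case True
      have "real n + 1/2 - 1 = real n - 1/2" by simp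
      hence "t powr (real n + 1/2 - 1) = t ^ n / sqrt t"
        using True by (simp only: powr_diff) (simp add: powr_realpow powr_half_sqrt)
      moreover have "(1 - t) powr (1/2 - 1) = 1 / sqrt (1 - t)"
        using True by (simp only: powr_diff) (simp add: powr_half_sqrt real_div_sqrt field_simps)
      ultimately show ?thesis by (simp add: real_sqrt_mult)
    next
      case False
      thus ?thesis using t by (auto simp: not_less)
    qed
  qed
  finally have "(\<integral>\<^sup>+s\<in>{0..1}. ennreal (s ^ n / sqrt (s * (1 - s))) \<partial>lborel) = ennreal (Beta (real n + 1/2) (1/2))"
    by (intro nn_integral_has_integral_lebesgue') auto
  also have "Beta (real n + 1/2) (1/2) = pi * pochhammer (1/2) n / fact n"
  proof -
    have "pochhammer (1/2) n = Gamma (1/2 + real n) / Gamma (1/2)"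
      by (rule pochhammer_Gamma) (auto elim!: nonpos_Ints_cases)
    hence "Gamma (real n + 1/2) = sqrt pi * pochhammer (1/2) n"
      by (simp add: Gamma_one_half_real add.commute)
    moreover have "Gamma (real n + 1/2 + 1/2) = fact n"
      using Gamma_fact[of n, where 'a = real] by (simp add: add_ac)
    ultimately show ?thesis by (simp add: Beta_def Gamma_one_half_real)
  qed
  finally show ?thesis .
qed

text \<open>
  These integrals are products of two Beta integrals and supply the factors
  \<open>(1/2)_(n1+n3) / (1)_(n1+n3)\<close> and \<open>(1/2)_(n2+n4) / (1)_(n2+n4)\<close> of the hypergeometric coefficients.
\<close>

lemma monomial_has_bochner_integral:
  "has_bochner_integral lborel
     (\<lambda>(s1, s2). indicator ({0..1} \<times> {0..1}) (s1, s2) * (s1 ^ m * s2 ^ n / sqrt (s1 * (1 - s1) * s2 * (1 - s2))) :: real)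
     (pi\<^sup>2 * (pochhammer (1/2) m / fact m) * (pochhammer (1/2) n / fact n))"
proof -
  define \<phi> where "\<phi> m s = (s ^ m / sqrt (s * (1 - s))) * indicator {0..1} s" for m and s :: real
  have \<phi>0: "\<phi> m s \<ge> 0" for m s by (auto simp: \<phi>_def indicator_def)
  have [measurable]: "\<phi> m \<in> borel_measurable borel" for m unfolding \<phi>_def by measurable
  have \<phi>: "(\<integral>\<^sup>+s. ennreal (\<phi> m s) \<partial>lborel) = ennreal (pi * pochhammer (1/2) m / fact m)" for m
    unfolding nn_integral_Beta_half[symmetric] \<phi>_def by (intro nn_integral_cong) (auto simp: indicator_def)
  have eq: "(\<lambda>(s1, s2). indicator ({0..1} \<times> {0..1}) (s1, s2) * (s1 ^ m * s2 ^ n / sqrt (s1 * (1 - s1) * s2 * (1 - s2))))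
      = (\<lambda>s. \<phi> m (fst s) * \<phi> n (snd s))"
    by (auto simp: fun_eq_iff \<phi>_def indicator_def real_sqrt_mult)
  have "(\<integral>\<^sup>+s. ennreal (\<phi> m (fst s) * \<phi> n (snd s)) \<partial>(lborel \<Otimes>\<^sub>M lborel)) =
      (\<integral>\<^sup>+s1. (\<integral>\<^sup>+s2. ennreal (\<phi> m s1 * \<phi> n s2) \<partial>lborel) \<partial>lborel)"
    by (subst lborel.nn_integral_fst[symmetric]) auto
  also have "\<dots> = ennreal (pi * pochhammer (1/2) m / fact m) * ennreal (pi * pochhammer (1/2) n / fact n)"
    by (simp add: ennreal_mult \<phi>0 nn_integral_cmult nn_integral_multc \<phi>)
  also have "\<dots> = ennreal (pi\<^sup>2 * (pochhammer (1/2) m / fact m) * (pochhammer (1/2) n / fact n))"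
    using pochhammer_half_pos[of m] pochhammer_half_pos[of n]
    by (subst ennreal_mult[symmetric]) (auto simp: power2_eq_square less_imp_le)
  finally have "(\<integral>\<^sup>+s. ennreal (\<phi> m (fst s) * \<phi> n (snd s)) \<partial>lborel) =
     ennreal (pi\<^sup>2 * (pochhammer (1/2) m / fact m) * (pochhammer (1/2) n / fact n))"
    by (simp add: lborel_prod)
  moreover have "(\<lambda>s. \<phi> m (fst s) * \<phi> n (snd s)) \<in> borel_measurable lborel"
    by (simp flip: lborel_prod)
  ultimately show ?thesis unfolding eq
    using pochhammer_half_pos[of m] pochhammer_half_pos[of n]
    by (intro has_bochner_integral_nn_integral) (auto simp: \<phi>0 less_imp_le)
qed


text \<open>
  Both linear factors are expanded into binomial double series and the result is integrated term by
  term. Dominated convergence applies because the integrated norms are at most \<open>\<pi>^2\<close> times the terms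
  of the absolutely convergent product series at \<open>s1 = s2 = 1\<close>.
\<close>

lemma F_S_series_eq_Euler:
  fixes z :: "complex^2^2"
  assumes z: "norm (z$1$1) + norm (z$2$1) < 1" "norm (z$1$2) + norm (z$2$2) < 1"
  shows "F_S_series z = F_S_Euler z"
proof -
  define \<omega> :: "real \<times> real \<Rightarrow> real" where
    "\<omega> = (\<lambda>(s1, s2). indicator ({0..1} \<times> {0..1}) (s1, s2) / sqrt (s1 * (1 - s1) * s2 * (1 - s2)))"
  define G :: "complex \<Rightarrow> complex \<Rightarrow> complex \<Rightarrow> complex \<Rightarrow> nat \<times> nat \<times> nat \<times> nat \<Rightarrow> complex" where
    "G a b c d = (\<lambda>(n1, n2, n3, n4). (of_real (half_coeff (n1, n2)) * a ^ n1 * b ^ n2) * (of_real (half_coeff (n3, n4)) * c ^ n3 * d ^ n4))"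
    for a b c d
  have G: "(\<lambda>n. norm (G a b c d n)) summable_on UNIV"
    "(G a b c d has_sum 1 / csqrt (1 - a - b) * (1 / csqrt (1 - c - d))) UNIV"
    if ab: "norm a + norm b < 1" and cd: "norm c + norm d < 1" for a b c d
  proof -
    define H where "H = (\<lambda>(x, y). (case x of (i, j) \<Rightarrow> of_real (half_coeff (i, j)) * a ^ i * b ^ j) *
       (case y of (i, j) \<Rightarrow> of_real (half_coeff (i, j)) * c ^ i * d ^ j))"
    have *: "(\<lambda>p. norm (H p)) summable_on UNIV" "(H has_sum 1 / csqrt (1 - a - b) * (1 / csqrt (1 - c - d))) UNIV"
      unfolding H_def
      using has_sum_times[OF half_coeff_abs_summable[OF ab] half_coeff_has_sum[OF ab] half_coeff_abs_summable[OF cd] half_coeff_has_sum[OF cd]]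
      by auto
    have "(\<lambda>p. norm (H p)) summable_on UNIV \<longleftrightarrow> (\<lambda>n. norm (G a b c d n)) summable_on UNIV"
      by (rule summable_on_reindex_bij_witness[where i = "\<lambda>(n1, n2, n3, n4). ((n1, n2), (n3, n4))" and
            j = "\<lambda>((n1, n2), (n3, n4)). (n1, n2, n3, n4)"]) (auto simp: H_def G_def)
    with *(1) show "(\<lambda>n. norm (G a b c d n)) summable_on UNIV" by simp
    have "(H has_sum 1 / csqrt (1 - a - b) * (1 / csqrt (1 - c - d))) UNIV \<longleftrightarrow>
      (G a b c d has_sum 1 / csqrt (1 - a - b) * (1 / csqrt (1 - c - d))) UNIV"
      by (rule has_sum_reindex_bij_witness[where i = "\<lambda>(n1, n2, n3, n4). ((n1, n2), (n3, n4))" and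
            j = "\<lambda>((n1, n2), (n3, n4)). (n1, n2, n3, n4)"]) (auto simp: H_def G_def)
    with *(2) show "(G a b c d has_sum 1 / csqrt (1 - a - b) * (1 / csqrt (1 - c - d))) UNIV" by simp
  qed
  define Z where "Z = G (z$1$1) (z$2$1) (z$1$2) (z$2$2)"
  define T where "T n s = Z n * of_real (case n of (n1, n2, n3, n4) \<Rightarrow>
     \<omega> s * fst s ^ (n1 + n3) * snd s ^ (n2 + n4))" for n s
  define m :: "nat \<times> nat \<times> nat \<times> nat \<Rightarrow> real" where "m n = (case n of (n1, n2, n3, n4) \<Rightarrow>
     (pochhammer (1/2) (n1 + n3) / fact (n1 + n3)) * (pochhammer (1/2) (n2 + n4) / fact (n2 + n4)))"
    for n
  have m: "0 \<le> m n" "m n \<le> 1" for n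
    using pochhammer_half_pos pochhammer_half_le_fact
    by (auto simp: m_def less_imp_le split: prod.splits intro!: mult_mono divide_nonneg_nonneg mult_nonneg_nonneg)
  have real_int: "has_bochner_integral lborel (\<lambda>s. case n of (n1, n2, n3, n4) \<Rightarrow> \<omega> s * fst s ^ (n1 + n3) * snd s ^ (n2 + n4)) (pi\<^sup>2 * m n)" for n
    using monomial_has_bochner_integral[of "fst n + fst (snd (snd n))" "fst (snd n) + snd (snd (snd n))"]
    by (simp add: m_def \<omega>_def case_prod_unfold mult_ac)
  have int: "has_bochner_integral lborel (T n) (of_real (pi\<^sup>2) * (of_real (m n) * Z n))" for n
  proof -
    have "has_bochner_integral lborel (T n) (Z n * of_real (pi\<^sup>2 * m n))"
      unfolding T_def
      by (intro has_bochner_integral_mult_right has_bochner_integral_of_real real_int) 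
    thus ?thesis by (simp add: mult_ac)
  qed
  have Tnorm: "norm (T n s) = norm (Z n) * (case n of (n1, n2, n3, n4) \<Rightarrow> \<omega> s * fst s ^ (n1 + n3) * snd s ^ (n2 + n4))" for n s
  proof -
    have "0 \<le> (case n of (n1, n2, n3, n4) \<Rightarrow> \<omega> s * fst s ^ (n1 + n3) * snd s ^ (n2 + n4))"
      by (cases n; cases s) (auto simp: \<omega>_def indicator_def)
    thus ?thesis by (simp add: T_def norm_mult)
  qed
  have int_norm: "has_bochner_integral lborel (\<lambda>s. norm (T n s)) (norm (Z n) * (pi\<^sup>2 * m n))" for n
    unfolding Tnorm by (intro has_bochner_integral_mult_right real_int)
  have Zsum: "(\<lambda>n. norm (Z n)) summable_on UNIV" unfolding Z_def by (rule G(1)[OF z])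
  have mZ: "(\<lambda>n. norm (of_real (m n) * Z n)) summable_on UNIV"
    using Zsum by (rule summable_on_comparison_test) (use m in \<open>auto simp: norm_mult intro!: mult_left_le_one_le\<close>)
  have T_sum: "((\<lambda>n. T n (s1, s2)) has_sum of_real (\<omega> (s1, s2)) *
     (1 / csqrt (F_S_factor (z$1$1) (z$2$1) (s1, s2)) * (1 / csqrt (F_S_factor (z$1$2) (z$2$2) (s1, s2))))) UNIV" 
     (is "(_ has_sum ?S) _")
    and T_abs: "(\<lambda>n. norm (T n (s1, s2))) summable_on UNIV" for s1 s2
  proof -
    have *: "((\<lambda>n. T n (s1, s2)) has_sum ?S) UNIV \<and> (\<lambda>n. norm (T n (s1, s2))) summable_on UNIV"
    proof (cases "s1 \<in> {0..1} \<and> s2 \<in> {0..1}")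
      case False
      hence "\<omega> (s1, s2) = 0" by (auto simp: \<omega>_def indicator_def)
      moreover have "T n (s1, s2) = 0" for n using calculation by (cases n) (simp add: T_def)
      ultimately show ?thesis by simp
    next
      case True
      have small: "norm (a * of_real s1) + norm (b * of_real s2) < 1" if "norm a + norm b < 1" for a b :: complex
      proof -
        have "norm a * \<bar>s1\<bar> \<le> norm a" "norm b * \<bar>s2\<bar> \<le> norm b" using True by (auto intro!: mult_left_le)
        thus ?thesis using that by (simp add: norm_mult)
      qed
      have T: "T n (s1, s2) = of_real (\<omega> (s1, s2)) * G (z$1$1 * of_real s1) (z$2$1 * of_real s2) (z$1$2 * of_real s1) (z$2$2 * of_real s2) n" for n
        by (cases n) (simp add: T_def Z_def G_def power_mult_distrib power_add mult_ac)
      show ?thesis unfolding T norm_mult F_S_factor_def case_prod_conv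
        by (intro conjI has_sum_cmult_right summable_on_cmult_right G small z)
    qed
    thus "((\<lambda>n. T n (s1, s2)) has_sum ?S) UNIV" "(\<lambda>n. norm (T n (s1, s2))) summable_on UNIV" by auto
  qed
  \<comment> \<open>The theorem on termwise integration speaks of sequences, hence the four indices are enumerated.\<close>
  define e where "e = from_nat_into (UNIV :: (nat \<times> nat \<times> nat \<times> nat) set)"
  have e: "bij_betw e UNIV UNIV" unfolding e_def by (intro bij_betw_from_nat_into) (auto simp: finite_prod)
  have to_sums: "(\<lambda>k. f (e k)) sums S" if "(f has_sum S) UNIV" for f :: "_ \<Rightarrow> complex" and S
    using has_sum_reindex_bij_betw[OF e, of f S] that by (intro has_sum_imp_sums) auto
  have to_summable: "summable (\<lambda>k. f (e k))" if "f summable_on UNIV" for f :: "_ \<Rightarrow> real"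
    using summable_on_reindex_bij_betw[OF e, of f] that by (intro summable_on_imp_summable) auto
  have "(\<integral>s. (\<Sum>k. T (e k) s) \<partial>lborel) = (\<Sum>k. integral\<^sup>L lborel (T (e k)))"
  proof (rule integral_suminf)
    show "integrable lborel (T (e k))" for k using int by (auto simp: has_bochner_integral_iff)
    show "AE s in lborel. summable (\<lambda>k. norm (T (e k) s))"
      using to_summable[OF T_abs] by (intro AE_I2) (auto simp: split_paired_all)
    have "summable (\<lambda>k. pi\<^sup>2 * norm (of_real (m (e k)) * Z (e k)))"
      by (intro summable_mult to_summable[OF mZ])
    thus "summable (\<lambda>k. \<integral>s. norm (T (e k) s) \<partial>lborel)"
      using int_norm m by (simp add: has_bochner_integral_iff norm_mult mult_ac)
  qed
  also have "(\<lambda>s. \<Sum>k. T (e k) s) = (\<lambda>s. indicator ({0..1} \<times> {0..1}) s *\<^sub>R (case s of (s1, s2) \<Rightarrow>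
      1 / (of_real (sqrt (s1 * (1 - s1) * s2 * (1 - s2)))
             * csqrt (F_S_factor (z$1$1) (z$2$1) (s1, s2))
             * csqrt (F_S_factor (z$1$2) (z$2$2) (s1, s2)))))"
    by (auto simp: fun_eq_iff sums_unique[OF to_sums[OF T_sum], symmetric] \<omega>_def indicator_def)
  also have "integral\<^sup>L lborel \<dots> = of_real (pi\<^sup>2) * F_S_Euler z"
    by (simp add: F_S_Euler_def set_lebesgue_integral_def)
  also have "(\<Sum>k. integral\<^sup>L lborel (T (e k))) = of_real (pi\<^sup>2) * (\<Sum>k. of_real (m (e k)) * Z (e k))"
  proof -
    have "summable (\<lambda>k. of_real (m (e k)) * Z (e k))"
      using to_summable[OF mZ] by (rule summable_norm_cancel)
    thus ?thesis using int by (simp add: has_bochner_integral_iff suminf_mult)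
  qed
  also have "(\<Sum>k. of_real (m (e k)) * Z (e k)) = (\<Sum>\<^sub>\<infinity>n. of_real (m n) * Z n)"
    using to_sums[OF has_sum_infsum[OF abs_summable_summable[OF mZ]]] by (simp add: sums_iff)
  also have "\<dots> = F_S_series z"
  proof -
    have half: "pochhammer (1/2 :: complex) n = of_real (pochhammer (1/2) n)" for n
      by (simp flip: pochhammer_of_real)
    show ?thesis
      unfolding F_S_series_def half
      by (intro infsum_cong)
         (auto simp: m_def Z_def G_def half_coeff_def pochhammer_fact[symmetric] mult_ac split: prod.splits)
  qed
  finally show ?thesis by simp
qed

section \<open>Transformation of the hypergeometric function\<close>

lemma csqrt_measurable [measurable]: "csqrt \<in> borel_measurable borel"
proof -
  have "(\<lambda>z. if Im z = 0 then 1 else sgn (Im z) :: real) = (\<lambda>z. if Im z < 0 then -1 else 1)"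
    by (auto simp: fun_eq_iff sgn_if)
  moreover have "(\<lambda>z. if Im z < 0 then -1 else 1 :: real) \<in> borel_measurable borel" by measurable
  ultimately show ?thesis
    unfolding borel_measurable_complex_iff csqrt.simps by simp
qed

lemma F_S_eq_Euler: "F_S z = F_S_Euler z"
  by (simp add: F_S_def F_S_series_eq_Euler)

text \<open>
  Interchanging both the rows and the columns of the matrix amounts to exchanging \<open>s1\<close> and \<open>s2\<close> in
  the Euler integral.
\<close>

lemma F_S_swap:
  assumes "w$1$1 = z$2$2" "w$1$2 = z$2$1" "w$2$1 = z$1$2" "w$2$2 = z$1$1"
  shows "F_S w = F_S z"
proof -
  define f where "f = (\<lambda>(s1, s2). indicator ({0..1} \<times> {0..1}) (s1, s2) *\<^sub>R
        (1 / (of_real (sqrt (s1 * (1 - s1) * s2 * (1 - s2)))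
             * csqrt (F_S_factor (z$1$1) (z$2$1) (s1, s2))
             * csqrt (F_S_factor (z$1$2) (z$2$2) (s1, s2)))))"
  have [measurable]: "f \<in> borel_measurable (lborel \<Otimes>\<^sub>M lborel)"
    unfolding f_def F_S_factor_def case_prod_unfold fst_conv snd_conv prod.collapse by measurable
  have "(\<integral>s. f s \<partial>(lborel \<Otimes>\<^sub>M lborel)) = (\<integral>(s2, s1). f (s1, s2) \<partial>(lborel \<Otimes>\<^sub>M lborel))"
    by (rule lborel_pair.integral_product_swap[symmetric]) simp
  also have "(\<lambda>(s2, s1). f (s1, s2)) = (\<lambda>(s1, s2). indicator ({0..1} \<times> {0..1}) (s1, s2) *\<^sub>R
        (1 / (of_real (sqrt (s1 * (1 - s1) * s2 * (1 - s2)))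
             * csqrt (F_S_factor (w$1$1) (w$2$1) (s1, s2))
             * csqrt (F_S_factor (w$1$2) (w$2$2) (s1, s2)))))"
    by (auto simp: fun_eq_iff f_def F_S_factor_def assms indicator_def algebra_simps)
  finally show ?thesis
    unfolding F_S_eq_Euler F_S_Euler_def set_lebesgue_integral_def f_def lborel_prod
    by (simp add: case_prod_unfold)
qed

text \<open>
  An affine function is nonnegative on the square if it is so at the four corners.
\<close>

lemma linear_factor_nonneg:
  fixes a b s1 s2 :: real
  assumes "a \<le> 1" "b \<le> 1" "a + b \<le> 1" "s1 \<in> {0..1}" "s2 \<in> {0..1}"
  shows "0 \<le> 1 - a * s1 - b * s2"
proof -
  have "1 - a * s1 - b * s2 = (1 - s1) * (1 - s2) + s1 * (1 - s2) * (1 - a)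
          + (1 - s1) * s2 * (1 - b) + s1 * s2 * (1 - (a + b))"
    by algebra
  also have "\<dots> \<ge> 0" using assms by (intro add_nonneg_nonneg mult_nonneg_nonneg) auto
  finally show ?thesis .
qed

lemma F_S_real:
  fixes z :: "real^2^2"
  assumes pos: "\<And>s1 s2. \<lbrakk>s1 \<in> {0..1}; s2 \<in> {0..1}\<rbrakk> \<Longrightarrow> 0 \<le> 1 - z$1$1 * s1 - z$2$1 * s2 \<and> 0 \<le> 1 - z$1$2 * s1 - z$2$2 * s2"
  shows "F_S (map_matrix complex_of_real z) =
           complex_of_real (enn2real (Euler_period (z$1$1) (z$2$1) (z$1$2) (z$2$2)) / pi\<^sup>2)"
proof -
  define P where "P s1 s2 = s1 * (1 - s1) * s2 * (1 - s2) * (1 - z$1$1 * s1 - z$2$1 * s2) * (1 - z$1$2 * s1 - z$2$2 * s2)" for s1 s2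
  define f where "f s = indicator ({0<..<1} \<times> {0<..<1}) s / sqrt (P (fst s) (snd s))" for s :: "real \<times> real"
  have [measurable]: "f \<in> borel_measurable borel"
    unfolding f_def P_def borel_prod[symmetric] by measurable
  have "0 \<le> P s1 s2" if "s1 \<in> {0<..<1}" "s2 \<in> {0<..<1}" for s1 s2
    unfolding P_def using pos[of s1 s2] that by (intro mult_nonneg_nonneg) auto
  hence f0: "f s \<ge> 0" for s by (cases s) (auto simp: f_def indicator_def)
  have "(LINT (s1, s2):{0..1} \<times> {0..1}|lborel.
        1 / (of_real (sqrt (s1 * (1 - s1) * s2 * (1 - s2)))
             * csqrt (F_S_factor (map_matrix complex_of_real z$1$1) (map_matrix complex_of_real z$2$1) (s1, s2))
             * csqrt (F_S_factor (map_matrix complex_of_real z$1$2) (map_matrix complex_of_real z$2$2) (s1, s2))))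
      = (\<integral>s. complex_of_real (f s) \<partial>lborel)"
    unfolding set_lebesgue_integral_def
  proof (rule Bochner_Integration.integral_cong[OF refl], clarify)
    fix s1 s2 :: real
    show "indicat_real ({0..1} \<times> {0..1}) (s1, s2) *\<^sub>R
        (1 / (of_real (sqrt (s1 * (1 - s1) * s2 * (1 - s2)))
             * csqrt (F_S_factor (map_matrix complex_of_real z$1$1) (map_matrix complex_of_real z$2$1) (s1, s2))
             * csqrt (F_S_factor (map_matrix complex_of_real z$1$2) (map_matrix complex_of_real z$2$2) (s1, s2))))
      = complex_of_real (f (s1, s2))"
    proof (cases "s1 \<in> {0..1} \<and> s2 \<in> {0..1}")
      case True
      have r: "csqrt (F_S_factor (complex_of_real a) (complex_of_real b) (s1, s2)) = complex_of_real (sqrt (1 - a * s1 - b * s2))"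
        if "0 \<le> 1 - a * s1 - b * s2" for a b
      proof -
        have "F_S_factor (complex_of_real a) (complex_of_real b) (s1, s2) = complex_of_real (1 - a * s1 - b * s2)"
          by (simp add: F_S_factor_def)
        thus ?thesis using of_real_sqrt[OF that] by (simp only:)
      qed
      show ?thesis
        using True pos[of s1 s2]
        by (auto simp: map_matrix_def r f_def P_def indicator_def real_sqrt_mult)
    next
      case False
      thus ?thesis by (auto simp: f_def indicator_def)
    qed
  qed
  also have "\<dots> = complex_of_real (\<integral>s. f s \<partial>lborel)"
    by (rule integral_complex_of_real)
  also have "(\<integral>s. f s \<partial>lborel) = enn2real (\<integral>\<^sup>+s. ennreal (f s) \<partial>lborel)"
    by (rule integral_eq_nn_integral) (use f0 in auto)
  also have "(\<integral>\<^sup>+s. ennreal (f s) \<partial>lborel) = (\<integral>\<^sup>+s1. (\<integral>\<^sup>+s2. ennreal (f (s1, s2)) \<partial>lborel) \<partial>lborel)"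
    using lborel.nn_integral_fst[of "\<lambda>s. ennreal (f s)" lborel] by (simp add: lborel_prod)
  also have "\<dots> = Euler_period (z$1$1) (z$2$1) (z$1$2) (z$2$2)"
    unfolding Euler_period_def inv_sqrt_def
  proof (intro nn_integral_cong)
    fix s1 :: real
    show "(\<integral>\<^sup>+s2. ennreal (f (s1, s2)) \<partial>lborel) =
       (\<integral>\<^sup>+s2\<in>{0<..<1}. ennreal (1 / sqrt (s1 * (1 - s1) * s2 * (1 - s2) *
         (1 - z$1$1 * s1 - z$2$1 * s2) * (1 - z$1$2 * s1 - z$2$2 * s2))) \<partial>lborel) * indicator {0<..<1} s1"
      by (cases "s1 \<in> {0<..<1}") (auto simp: f_def P_def indicator_def intro!: nn_integral_cong)
  qed
  finally show ?thesis
    unfolding F_S_eq_Euler F_S_Euler_def by simp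
qed

lemma F_S_triangular:
  fixes z :: "real^2^2"
  assumes d: "d1 > 0" "d2 > 0" "d3 > 0" "d4 > 0" and k: "k > 0" "k * (d1 - d2) = d3 - d4"
    and z: "z$1$1 = 1 - k" "z$2$1 = 0" "z$1$2 = 1 - k * d1 / d3" "z$2$2 = 1 - d4 / d3"
  shows "F_S (map_matrix complex_of_real z) =
           complex_of_real (sqrt (d3 / k) * enn2real (double_period d1 d2 d3 d4) / pi\<^sup>2)"
proof -
  have "z$1$2 + z$2$2 = 1 - k * d2 / d3"
  proof -
    have "k * d1 - k * d2 = d3 - d4" using k(2) by (simp add: right_diff_distrib)
    hence "k * d1 / d3 - k * d2 / d3 = 1 - d4 / d3" using d by (simp add: field_simps)
    thus ?thesis unfolding z by simp
  qed
  moreover have "k * d1 / d3 > 0" "k * d2 / d3 > 0" "d4 / d3 > 0" using d k by auto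
  ultimately have "F_S (map_matrix complex_of_real z) =
      complex_of_real (enn2real (Euler_period (z$1$1) (z$2$1) (z$1$2) (z$2$2)) / pi\<^sup>2)"
    using z k by (intro F_S_real conjI linear_factor_nonneg) auto
  also have "Euler_period (z$1$1) (z$2$1) (z$1$2) (z$2$2) = ennreal (sqrt (d3 / k)) * double_period d1 d2 d3 d4"
    unfolding z by (rule Euler_period_triangular[OF d k])
  also have "enn2real \<dots> = sqrt (d3 / k) * enn2real (double_period d1 d2 d3 d4)"
    using d k by (simp add: enn2real_mult)
  finally show ?thesis .
qed

text \<open>
  The parameters \<open>c2\<close> and \<open>c3\<close> enter symmetrically into the inequalities, so that the lemma also covers
  \<open>w\<close>, which is \<open>z\<close> with \<open>c2\<close> and \<open>c3\<close> exchanged and both rows and columns interchanged.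
\<close>

lemma F_S_duplication:
  fixes c1 c2 c3 c4 :: real and z m :: "real^2^2"
  assumes ord: "c1 > c2" "c1 > c3" "c2 > c4" "c3 > c4" "c4 > 0"
    and z: "z$1$1 = 1 - (c3\<^sup>2 - c4\<^sup>2) / (c1\<^sup>2 - c2\<^sup>2)"
           "z$1$2 = 1 - (c1\<^sup>2 * (c3\<^sup>2 - c4\<^sup>2)) / (c3\<^sup>2 * (c1\<^sup>2 - c2\<^sup>2))"
           "z$2$1 = 0" "z$2$2 = 1 - c4\<^sup>2 / c3\<^sup>2"
    and m: "m$1$1 = (c1 - c2 - c3 + c4)\<^sup>2 / (c1 - c2 + c3 - c4)\<^sup>2"
           "m$1$2 = (2 * (c1 * c4 - c2 * c3) * (c1\<^sup>2 - c2\<^sup>2 - c3\<^sup>2 + c4\<^sup>2))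
                 / ((c1 + c2) * (c3 + c4) * (c1 - c2 + c3 - c4)\<^sup>2)"
           "m$2$1 = 0" "m$2$2 = ((c1 - c2) * (c3 - c4)) / ((c1 + c2) * (c3 + c4))"
  shows "F_S (map_matrix complex_of_real m) =
    complex_of_real (((c1 - c2 + c3 - c4) * (c3 + c4)) / (4 * (c1 - c2) * c3)) * F_S (map_matrix complex_of_real z)"
proof -
  have c: "c1 > 0" "c2 > 0" "c3 > 0" using ord by auto
  have diffs: "0 < c1\<^sup>2 - c2\<^sup>2" "0 < c3\<^sup>2 - c4\<^sup>2" using ord c by (auto intro!: power_strict_mono)
  define S where "S = c1 - c2 + c3 - c4"
  have S: "S > 0" using ord by (simp add: S_def)
  define k k' where "k = (c3\<^sup>2 - c4\<^sup>2) / (c1\<^sup>2 - c2\<^sup>2)" and "k' = 4 * ((c1 - c2) * (c3 - c4)) / S\<^sup>2"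
  have k: "k > 0" "k' > 0" using diffs ord S by (auto simp: k_def k'_def)
  define d1 d2 d3 d4 where "d1 = (c1 + c2 + c3 + c4)\<^sup>2 / 4" and "d2 = (c1 + c3) * (c2 + c4)"
    and "d3 = (c1 + c2) * (c3 + c4)" and "d4 = 2 * (c1 * c4 + c2 * c3)"
  have d: "d1 > 0" "d2 > 0" "d3 > 0" "d4 > 0"
    using c ord unfolding d1_def d2_def d3_def d4_def by (auto intro!: add_pos_pos divide_pos_pos zero_less_power)
  have e: "d1 - d2 = S\<^sup>2 / 4" unfolding d1_def d2_def S_def by (simp add: power2_eq_square field_simps)
  have e': "d3 - d4 = (c1 - c2) * (c3 - c4)" unfolding d3_def d4_def by algebra
  define C where "C = (S * (c3 + c4)) / (4 * (c1 - c2) * c3)"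
  have C0: "C \<ge> 0" using S c ord unfolding C_def by (intro mult_nonneg_nonneg divide_nonneg_nonneg) auto
  have "double_period (c1\<^sup>2) (c2\<^sup>2) (c3\<^sup>2) (c4\<^sup>2) = 2 * double_period d1 d2 d3 d4"
    using double_period_duplication[OF ord] double_period_antitranspose[OF d] by (simp add: d1_def d2_def d3_def d4_def)
  moreover have "F_S (map_matrix complex_of_real z) =
      complex_of_real (sqrt (c3\<^sup>2 / k) * enn2real (double_period (c1\<^sup>2) (c2\<^sup>2) (c3\<^sup>2) (c4\<^sup>2)) / pi\<^sup>2)"
    using c ord k diffs by (intro F_S_triangular) (auto simp: k_def z mult_ac)
  ultimately have Z: "F_S (map_matrix complex_of_real z) =
      complex_of_real (sqrt (c3\<^sup>2 / k) * (2 * enn2real (double_period d1 d2 d3 d4)) / pi\<^sup>2)"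
    by (simp add: enn2real_mult)
  have "F_S (map_matrix complex_of_real m) = complex_of_real (sqrt (d3 / k') * enn2real (double_period d1 d2 d3 d4) / pi\<^sup>2)"
  proof (rule F_S_triangular[OF d k(2)])
    show "k' * (d1 - d2) = d3 - d4" unfolding e e' k'_def using S by simp
    have "S\<^sup>2 - 4 * ((c1 - c2) * (c3 - c4)) = (c1 - c2 - c3 + c4)\<^sup>2" unfolding S_def by algebra
    moreover have "1 - k' = (S\<^sup>2 - 4 * ((c1 - c2) * (c3 - c4))) / S\<^sup>2"
      using S by (simp add: k'_def diff_divide_distrib)
    ultimately show "m$1$1 = 1 - k'" by (simp only: m S_def)
    have "d3 * S\<^sup>2 - (c1 - c2) * (c3 - c4) * (c1 + c2 + c3 + c4)\<^sup>2 = 2 * (c1 * c4 - c2 * c3) * (c1\<^sup>2 - c2\<^sup>2 - c3\<^sup>2 + c4\<^sup>2)"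
      unfolding S_def d3_def by algebra
    moreover have "k' * d1 * S\<^sup>2 = (c1 - c2) * (c3 - c4) * (c1 + c2 + c3 + c4)\<^sup>2"
      using S by (simp add: k'_def d1_def)
    moreover have "1 - k' * d1 / d3 = (d3 * S\<^sup>2 - k' * d1 * S\<^sup>2) / (d3 * S\<^sup>2)"
      using S d by (simp add: diff_divide_distrib)
    ultimately show "m$1$2 = 1 - k' * d1 / d3" by (simp add: m S_def d3_def)
    have "1 - d4 / d3 = (d3 - d4) / d3" using d by (simp add: diff_divide_distrib)
    thus "m$2$2 = 1 - d4 / d3" unfolding e' by (simp add: m d3_def)
  qed (simp add: m)
  also have "sqrt (d3 / k') = C * (2 * sqrt (c3\<^sup>2 / k))"
  proof (rule real_sqrt_unique)
    have f: "c1\<^sup>2 - c2\<^sup>2 = (c1 - c2) * (c1 + c2)" "c3\<^sup>2 - c4\<^sup>2 = (c3 - c4) * (c3 + c4)"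
      by algebra+
    have "(C * (2 * sqrt (c3\<^sup>2 / k)))\<^sup>2 = C\<^sup>2 * (4 * (c3\<^sup>2 / k))"
      using k by (simp add: power_mult_distrib)
    also have "\<dots> = d3 / k'"
      unfolding C_def k_def k'_def f d3_def using S c ord
      by (simp add: divide_simps) (simp add: power2_eq_square algebra_simps)
    finally show "(C * (2 * sqrt (c3\<^sup>2 / k)))\<^sup>2 = d3 / k'" .
    show "0 \<le> C * (2 * sqrt (c3\<^sup>2 / k))" using C0 k by simp
  qed
  also have "complex_of_real (C * (2 * sqrt (c3\<^sup>2 / k)) * enn2real (double_period d1 d2 d3 d4) / pi\<^sup>2)
     = complex_of_real C * F_S (map_matrix complex_of_real z)"
    unfolding Z of_real_mult[symmetric] by (simp add: mult_ac)
  finally show ?thesis unfolding C_def S_def .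
qed

theorem theorem5:
  fixes c1 c2 c3 c4 :: real and z w mz mw :: "real^2^2"
  assumes "c1 > c2" and "c2 > c3" and "c3 > c4" and "c4 > 0"
    and "z = vector
      [vector [1 - (c3\<^sup>2 - c4\<^sup>2) / (c1\<^sup>2 - c2\<^sup>2),
               1 - (c1\<^sup>2 * (c3\<^sup>2 - c4\<^sup>2)) / (c3\<^sup>2 * (c1\<^sup>2 - c2\<^sup>2))],
       vector [0,
               1 - c4\<^sup>2 / c3\<^sup>2]]"
    and "w = vector
      [vector [1 - c4\<^sup>2 / c2\<^sup>2,
               0],
       vector [1 - (c1\<^sup>2 * (c2\<^sup>2 - c4\<^sup>2)) / (c2\<^sup>2 * (c1\<^sup>2 - c3\<^sup>2)),
               1 - (c2\<^sup>2 - c4\<^sup>2) / (c1\<^sup>2 - c3\<^sup>2)]]"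
    and "mz = vector
      [vector [(c1 - c2 - c3 + c4)\<^sup>2 / (c1 - c2 + c3 - c4)\<^sup>2,
               (2 * (c1 * c4 - c2 * c3) * (c1\<^sup>2 - c2\<^sup>2 - c3\<^sup>2 + c4\<^sup>2))
                 / ((c1 + c2) * (c3 + c4) * (c1 - c2 + c3 - c4)\<^sup>2)],
       vector [0,
               ((c1 - c2) * (c3 - c4)) / ((c1 + c2) * (c3 + c4))]]"
    and "mw = vector
      [vector [((c1 - c3) * (c2 - c4)) / ((c1 + c3) * (c2 + c4)),
               0],
       vector [(2 * (c1 * c4 - c2 * c3) * (c1\<^sup>2 - c2\<^sup>2 - c3\<^sup>2 + c4\<^sup>2))
                 / ((c1 + c3) * (c2 + c4) * (c1 + c2 - c3 - c4)\<^sup>2),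
               (c1 - c2 - c3 + c4)\<^sup>2 / (c1 + c2 - c3 - c4)\<^sup>2]]"
  shows "F_S (map_matrix complex_of_real mz)
           = complex_of_real (((c1 - c2 + c3 - c4) * (c3 + c4)) / (4 * (c1 - c2) * c3))
             * F_S (map_matrix complex_of_real z)
       \<and> F_S (map_matrix complex_of_real mw)
           = complex_of_real (((c1 + c2 - c3 - c4) * (c2 + c4)) / (4 * (c1 - c3) * c2))
             * F_S (map_matrix complex_of_real w)"
proof
  show "F_S (map_matrix complex_of_real mz) =
      complex_of_real (((c1 - c2 + c3 - c4) * (c3 + c4)) / (4 * (c1 - c2) * c3)) * F_S (map_matrix complex_of_real z)"
    using assms by (intro F_S_duplication) (auto simp: vector_2)
next
  define z' m' :: "real^2^2" where
    "z' = vector [vector [w$2$2, w$2$1], vector [w$1$2, w$1$1]]" and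
    "m' = vector [vector [mw$2$2, mw$2$1], vector [mw$1$2, mw$1$1]]"
  have swap: "F_S (map_matrix complex_of_real w) = F_S (map_matrix complex_of_real z')"
       "F_S (map_matrix complex_of_real mw) = F_S (map_matrix complex_of_real m')"
    by (rule F_S_swap; simp add: z'_def m'_def map_matrix_def vector_2)+
  have e: "c1 - c3 + c2 - c4 = c1 + c2 - c3 - c4" "c1 - c3 - c2 + c4 = c1 - c2 - c3 + c4"
      "c1 * c4 - c3 * c2 = c1 * c4 - c2 * c3" "c1\<^sup>2 - c3\<^sup>2 - c2\<^sup>2 + c4\<^sup>2 = c1\<^sup>2 - c2\<^sup>2 - c3\<^sup>2 + c4\<^sup>2"
    by simp_all
  have "F_S (map_matrix complex_of_real m') =
      complex_of_real (((c1 - c3 + c2 - c4) * (c2 + c4)) / (4 * (c1 - c3) * c2)) * F_S (map_matrix complex_of_real z')"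
    using assms(1-4) by (intro F_S_duplication) (simp_all only: e, simp_all add: z'_def m'_def assms(6,8) vector_2)
  thus "F_S (map_matrix complex_of_real mw) =
      complex_of_real (((c1 + c2 - c3 - c4) * (c2 + c4)) / (4 * (c1 - c3) * c2)) * F_S (map_matrix complex_of_real w)"
    unfolding swap e .
qed

end
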